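(* Let $(N,\underline X)\in\aleph^{FGM}$. (1) For every $k\in\mathbb{N}_1$ with $k\le \sup A_N$, $$(N,X_1,\dots,X_k)\overset{d}{=}\Big((1-I_0)N_{[1]}+I_0N_{[2]},\ (1-I_1)X_{[1],1}+I_1X_{[2],1},\ \dots,\ (1-I_k)X_{[1],k}+I_kX_{[2],k}\Big),$$ where $(I_0,\dots,I_k)$ is the symmetric Bernoulli vector associated with the copula $C_k$; $(N_{[1]},N_{[2]})$ is the (minimum, maximum) of two iid copies of $N$; for each $j$, $(X_{[1],j},X_{[2],j})$ is the (minimum, maximum) of two iid copies of $X$; and the pairs $(N_{[1]},N_{[2]}),(X_{[1],1},X_{[2],1}),\dots,(X_{[1],k},X_{[2],k})$ and the vector $(I_0,\dots,I_k)$ are mutually independent. (2) There exists a sequence $\{I_j\}_{j\ge0}$ of Bernoulli$(1/2)$ random variables such that for each $k\le\sup A_N$ the vector $(I_0,\dots,I_k)$ is the one associated with $C_k$, and, with mutually independent pairs $(N_{[1]},N_{[2]})$, $(X_{[1],j},X_{[2],j})$, $j\ge1$, as in (1), independent of $\{I_j\}$, $$S\overset{d}{=}\sum_{j=1}^{\infty}\big((1-I_j)X_{[1],j}+I_jX_{[2],j}\big)\mathbb{1}_{\{(1-I_0)N_{[1]}+I_0N_{[2]}\ge j\}},$$ equivalently $S\overset{d}{=}\sum_{j=1}^{M}\big((1-I_j)X_{[1],j}+I_jX_{[2],j}\big)$ with $M=(1-I_0)N_{[1]}+I_0N_{[2]}$ (and $S=0$ when $M=0$).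
   Context: Collective risk model (CRM): $N$ is a random variable with values in $\mathbb{N}_0=\{0,1,2,\dots\}$, cdf $F_N$, pmf $\gamma_N(n)=\Pr(N=n)$ and support $A_N=\{n:\gamma_N(n)>0\}$; $\underline X=\{X_j\}_{j\ge1}$ is a sequence of identically distributed strictly positive random variables with common cdf $F_X$ (a generic copy is denoted $X$). The aggregate claim amount is $S=\sum_{j=1}^\infty X_j\mathbb{1}_{\{N\ge j\}}$ (i.e. $S=\sum_{j=1}^N X_j$, and $S=0$ if $N=0$). A $d$-variate FGM copula with parameters $\theta_{j_1\dots j_k}$ ($2\le k\le d$, $j_1<\dots<j_k$) is $C(u_1,\dots,u_d)=\prod_{m=1}^d u_m\big(1+\sum_{k=2}^d\sum_{j_1<\dots<j_k}\theta_{j_1\dots j_k}\bar u_{j_1}\cdots\bar u_{j_k}\big)$ with $\bar u=1-u$, where the parameters satisfy $1+\sum_{k=2}^d\sum_{j_1<\dots<j_k}\theta_{j_1\dots j_k}\varepsilon_{j_1}\cdots\varepsilon_{j_k}\ge0$ for all $\varepsilon\in\{-1,1\}^d$. To such a copula is associated the random vector $\boldsymbol I$ on $\{0,1\}^d$ with pmf $f_{\boldsymbol I}(\boldsymbol i)=2^{-d}\big(1+\sum_{k=2}^d\sum_{j_1<\dots<j_k}(-1)^{i_{j_1}+\dots+i_{j_k}}\theta_{j_1\dots j_k}\big)$; its components are Bernoulli$(1/2)$ ("symmetric Bernoulli vector"), and this is a bijection between $d$-variate FGM copulas and distributions on $\{0,1\}^d$ with Bernoulli$(1/2)$ margins. A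 CRM $(N,\underline X)$ belongs to $\aleph^{FGM}$ if for every $k\in\mathbb{N}_1$ with $k\le\sup A_N$, $F_{N,X_1,\dots,X_k}(n,x_1,\dots,x_k)=C_k(F_N(n),F_X(x_1),\dots,F_X(x_k))$ for a $(k+1)$-variate FGM copula $C_k$ whose coordinates are indexed $0,1,\dots,k$ (index $0$ for $N$); $(I_0,\dots,I_k)$ denotes the symmetric Bernoulli vector associated with $C_k$. For a random variable $Y$, $Y_{[1]}$ and $Y_{[2]}$ denote the minimum and maximum of two iid copies of $Y$.
   Formalization: In part (2) the copulas C_k are chosen consistently among the FGM copulas representing (N,X_1,…,X_k), instead of being fixed in advance; when N or X is constant the C_k are not unique, and an inconsistent choice admits no such sequence {I_j}. Part (1) holds for every representing C_k. *)

theory Defs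
  imports "HOL-Probability.Probability"
begin

definition fgm_index_sets :: "nat \<Rightarrow> nat set set" where
  "fgm_index_sets d = {J. J \<subseteq> {..<d} \<and> 2 \<le> card J}"

definition fgm_valid :: "(nat set \<Rightarrow> real) \<Rightarrow> nat \<Rightarrow> bool" where
  "fgm_valid \<theta> d \<longleftrightarrow>
     (\<forall>\<epsilon> \<in> {..<d} \<rightarrow> {-1, 1}.
        0 \<le> 1 + (\<Sum>J\<in>fgm_index_sets d. \<theta> J * (\<Prod>j\<in>J. \<epsilon> j)))"

definition fgm_copula :: "(nat set \<Rightarrow> real) \<Rightarrow> nat \<Rightarrow> (nat \<Rightarrow> real) \<Rightarrow> real" where
  "fgm_copula \<theta> d u =
     (\<Prod>m<d. u m) * (1 + (\<Sum>J\<in>fgm_index_sets d. \<theta> J * (\<Prod>j\<in>J. 1 - u j)))"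

text \<open>pmf of the associated symmetric Bernoulli vector; a vector in {0,1}^d is
  represented by a function i :: nat => bool with i j = False for j >= d
  (True stands for 1).\<close>

definition fgm_density :: "(nat set \<Rightarrow> real) \<Rightarrow> nat \<Rightarrow> (nat \<Rightarrow> bool) \<Rightarrow> real" where
  "fgm_density \<theta> d i =
     (if (\<forall>j. d \<le> j \<longrightarrow> \<not> i j) then
        (1 / 2) ^ d * (1 + (\<Sum>J\<in>fgm_index_sets d.
            (-1) ^ (\<Sum>j\<in>J. if i j then 1 else 0) * \<theta> J))
      else 0)"

definition fgm_pmf :: "(nat set \<Rightarrow> real) \<Rightarrow> nat \<Rightarrow> (nat \<Rightarrow> bool) pmf" where
  "fgm_pmf \<theta> d = embed_pmf (fgm_density \<theta> d)"

definition cdf_N :: "'a measure \<Rightarrow> ('a \<Rightarrow> nat) \<Rightarrow> real \<Rightarrow> real" where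
  "cdf_N M N n = measure M {\<omega> \<in> space M. real (N \<omega>) \<le> n}"

text \<open>Common cdf of the claim amounts (X 1 is a generic copy).\<close>
definition cdf_X :: "'a measure \<Rightarrow> (nat \<Rightarrow> 'a \<Rightarrow> real) \<Rightarrow> real \<Rightarrow> real" where
  "cdf_X M X x = measure M {\<omega> \<in> space M. X 1 \<omega> \<le> x}"

definition support_N :: "'a measure \<Rightarrow> ('a \<Rightarrow> nat) \<Rightarrow> nat set" where
  "support_N M N = {n. measure M {\<omega> \<in> space M. N \<omega> = n} > 0}"

definition sup_support_N :: "'a measure \<Rightarrow> ('a \<Rightarrow> nat) \<Rightarrow> enat" where
  "sup_support_N M N = Sup (enat ` support_N M N)"

definition crm :: "'a measure \<Rightarrow> ('a \<Rightarrow> nat) \<Rightarrow> (nat \<Rightarrow> 'a \<Rightarrow> real) \<Rightarrow> bool" where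
  "crm M N X \<longleftrightarrow> prob_space M \<and>
     N \<in> measurable M (count_space UNIV) \<and>
     (\<forall>j\<ge>1. X j \<in> borel_measurable M) \<and>
     (\<forall>j\<ge>1. \<forall>\<omega>\<in>space M. 0 < X j \<omega>) \<and>
     (\<forall>j\<ge>1. distr M borel (X j) = distr M borel (X 1))"

definition aggregate :: "('a \<Rightarrow> nat) \<Rightarrow> (nat \<Rightarrow> 'a \<Rightarrow> real) \<Rightarrow> 'a \<Rightarrow> real" where
  "aggregate N X \<omega> = (\<Sum>j\<in>{1..N \<omega>}. X j \<omega>)"

definition fgm_rep :: "'a measure \<Rightarrow> ('a \<Rightarrow> nat) \<Rightarrow> (nat \<Rightarrow> 'a \<Rightarrow> real) \<Rightarrow> nat
                        \<Rightarrow> (nat set \<Rightarrow> real) \<Rightarrow> bool" where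
  "fgm_rep M N X k \<theta> \<longleftrightarrow> fgm_valid \<theta> (Suc k) \<and>
     (\<forall>(n::real) (x::nat \<Rightarrow> real).
        measure M {\<omega> \<in> space M. real (N \<omega>) \<le> n \<and> (\<forall>j\<in>{1..k}. X j \<omega> \<le> x j)} =
        fgm_copula \<theta> (Suc k) (\<lambda>m. if m = 0 then cdf_N M N n else cdf_X M X (x m)))"

definition aleph_FGM :: "'a measure \<Rightarrow> ('a \<Rightarrow> nat) \<Rightarrow> (nat \<Rightarrow> 'a \<Rightarrow> real) \<Rightarrow> bool" where
  "aleph_FGM M N X \<longleftrightarrow> crm M N X \<and>
     (\<forall>k\<ge>1. enat k \<le> sup_support_N M N \<longrightarrow> (\<exists>\<theta>. fgm_rep M N X k \<theta>))"

end

theory Submission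
  imports Defs
begin

text \<open>
  If \<open>F\<close> is the cdf of \<open>Y\<close>, then the minimum and the maximum of two iid copies of \<open>Y\<close> have cdfs
  \<open>F (1 + (1 - F))\<close> and \<open>F (1 - (1 - F))\<close>. Mixing the products of these cdfs over the Bernoulli
  vector, whose density is a combination of the characters \<open>(-1)^(\<Sum>j\<in>J. i\<^sub>j)\<close> with
  coefficients \<open>\<theta>\<^sub>J\<close>, replaces each character by \<open>\<Prod>j\<in>J. 1 - F\<^sub>j\<close>, and the result is the
  FGM copula at the margins. This is the first part.

  For the second part the copulas \<open>C\<^sub>k\<close> have to be consistent in \<open>k\<close>. The joint law determines
  \<open>\<theta>\<^sub>J\<close> exactly when all coordinates in \<open>J\<close> are nondegenerate; the other coefficients do not
  influence the copula at the margins and may be set to 0, which preserves validity by averaging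
  over signs. The resulting Bernoulli vectors form a projective family, so Kolmogorov's theorem
  gives the sequence. The law of \<open>S\<close> is then compared on each event \<open>N = n\<close>, where only
  \<open>(N, X\<^sub>1, \<dots>, X\<^sub>n)\<close> matters.
\<close>

section \<open>The symmetric Bernoulli vector\<close>

text \<open>The cube {0,1}^d in the encoding of \<open>fgm_density\<close>: total functions that are
  \<open>False\<close> from \<open>d\<close> on. All dimensions share one type, so marginalisation
  is truncation.\<close>

definition bool_cube :: "nat \<Rightarrow> (nat \<Rightarrow> bool) set" where
  "bool_cube d = {i. \<forall>j\<ge>d. \<not> i j}"

lemma bool_cube_0: "bool_cube 0 = {\<lambda>_. False}"
  by (auto simp: bool_cube_def)

lemma bool_cube_Suc: "bool_cube (Suc d) = bool_cube d \<union> (\<lambda>i. i(d := True)) ` bool_cube d"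
proof -
  have "i \<in> bool_cube d \<union> (\<lambda>i. i(d := True)) ` bool_cube d" if "i \<in> bool_cube (Suc d)" for i
  proof (cases "i d")
    case True
    then have "i = (i(d := False))(d := True)" by (simp add: fun_eq_iff)
    moreover have "i(d := False) \<in> bool_cube d"
      using that by (auto simp: bool_cube_def)
    ultimately have "i \<in> (\<lambda>i. i(d := True)) ` bool_cube d" by (rule image_eqI)
    then show ?thesis ..
  next
    case False
    have "\<not> i j" if "j \<ge> d" for j
      using that False \<open>i \<in> bool_cube (Suc d)\<close> by (cases "j = d") (auto simp: bool_cube_def)
    then have "i \<in> bool_cube d" by (simp add: bool_cube_def)
    then show ?thesis by simp
  qed
  then show ?thesis by (auto simp: bool_cube_def)
qed

lemma bool_cube_truncate: "i \<in> bool_cube d \<Longrightarrow> (\<lambda>j. i j \<and> j < d) = i"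
  unfolding bool_cube_def by (rule ext) (metis mem_Collect_eq not_le)

lemma finite_bool_cube: "finite (bool_cube d)"
  by (induction d) (auto simp: bool_cube_0 bool_cube_Suc)

text \<open>Distributivity: expanding the product on the right chooses one of two summands per
  coordinate, that is, one vector of the cube. The induction splits the cube at its last
  coordinate.\<close>

lemma sum_bool_cube_prod:
  fixes h :: "nat \<Rightarrow> bool \<Rightarrow> real"
  shows "(\<Sum>i\<in>bool_cube d. \<Prod>j<d. h j (i j)) = (\<Prod>j<d. h j False + h j True)"
proof (induction d)
  case 0
  show ?case by (simp add: bool_cube_0)
next
  case (Suc d)
  have inj: "inj_on (\<lambda>i. i(d := True)) (bool_cube d)"
  proof (rule inj_onI, rule ext)
    fix i i' j assume "i \<in> bool_cube d" "i' \<in> bool_cube d" and eq: "i(d := True) = i'(d := True)"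
    then have "\<not> i d" "\<not> i' d" by (auto simp: bool_cube_def)
    then show "i j = i' j" using fun_cong[OF eq, of j] by (cases "j = d") auto
  qed
  have disj: "bool_cube d \<inter> (\<lambda>i. i(d := True)) ` bool_cube d = {}"
    by (auto simp: bool_cube_def)
  have "(\<Sum>i\<in>bool_cube (Suc d). \<Prod>j<Suc d. h j (i j)) =
     (\<Sum>i\<in>bool_cube d. \<Prod>j<Suc d. h j (i j)) + (\<Sum>i\<in>bool_cube d. \<Prod>j<Suc d. h j ((i(d := True)) j))"
    unfolding bool_cube_Suc
    by (subst sum.union_disjoint) (auto simp: finite_bool_cube disj sum.reindex[OF inj] simp del: fun_upd_apply)
  also have "(\<Sum>i\<in>bool_cube d. \<Prod>j<Suc d. h j (i j)) = (\<Sum>i\<in>bool_cube d. (\<Prod>j<d. h j (i j)) * h d False)"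
    by (intro sum.cong refl) (auto simp: bool_cube_def)
  also have "(\<Sum>i\<in>bool_cube d. \<Prod>j<Suc d. h j ((i(d := True)) j)) = (\<Sum>i\<in>bool_cube d. (\<Prod>j<d. h j (i j)) * h d True)"
    by (intro sum.cong refl) auto
  finally show ?case
    by (simp add: Suc.IH[symmetric] sum_distrib_right[symmetric] distrib_left)
qed

section \<open>Characters of the cube and the density of the Bernoulli vector\<close>

lemma finite_fgm_index_sets: "finite (fgm_index_sets d)"
  by (rule finite_subset[of _ "Pow {..<d}"]) (auto simp: fgm_index_sets_def)

text \<open>The sign is written as a product over \<open>J\<close>, so that each term factorises
  over the coordinates and has the same shape as in \<open>fgm_valid\<close>.\<close>

lemma fgm_density_eq:
  "i \<in> bool_cube d \<Longrightarrow> fgm_density \<theta> d i =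
     (1 / 2) ^ d * (1 + (\<Sum>J\<in>fgm_index_sets d. \<theta> J * (\<Prod>j\<in>J. if i j then - 1 else 1)))"
proof -
  assume "i \<in> bool_cube d"
  moreover have "(- 1 :: real) ^ (\<Sum>j\<in>J. if i j then 1 else 0) = (\<Prod>j\<in>J. if i j then - 1 else 1)" for J
    by (subst power_sum) (intro prod.cong, auto)
  ultimately show ?thesis
    by (simp add: fgm_density_def bool_cube_def mult.commute)
qed

lemma fgm_density_outside: "i \<notin> bool_cube d \<Longrightarrow> fgm_density \<theta> d i = 0"
  unfolding fgm_density_def bool_cube_def mem_Collect_eq by (rule if_not_P)

lemma fgm_density_nonneg:
  assumes "fgm_valid \<theta> d"
  shows "0 \<le> fgm_density \<theta> d i"
proof (cases "i \<in> bool_cube d")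
  case True
  have "(\<lambda>j. if i j then - 1 else (1::real)) \<in> {..<d} \<rightarrow> {-1, 1}" by auto
  from assms[unfolded fgm_valid_def, rule_format, OF this] show ?thesis
    by (simp add: fgm_density_eq[OF True])
qed (simp add: fgm_density_outside)

text \<open>Writing the factors as \<^term>\<open>\<lambda>b. u * (1 + (if b then - v else v))\<close> makes the characters
  in the density act by picking out \<^term>\<open>v\<close>.\<close>
lemma sum_fgm_density_prod:
  fixes u v :: "nat \<Rightarrow> real"
  shows "(\<Sum>i\<in>bool_cube d. fgm_density \<theta> d i * (\<Prod>j<d. u j * (1 + (if i j then - v j else v j)))) =
    (\<Prod>j<d. u j) * (1 + (\<Sum>J\<in>fgm_index_sets d. \<theta> J * (\<Prod>j\<in>J. v j)))"
proof -
  define G where "G i = (\<Prod>j<d. u j * (1 + (if i j then - v j else v j)))" for i :: "nat \<Rightarrow> bool"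
  define c where "c J i = (\<Prod>j\<in>J. if i j then - 1 else (1::real))" for J and i :: "nat \<Rightarrow> bool"
  \<comment> \<open>Summing over one bit gives \<open>2 * u j\<close> without the character, since
    the two signs of \<open>v j\<close> cancel; a character containing \<open>j\<close> flips one
    sign and leaves \<open>2 * u j * v j\<close>.\<close>
  have key: "(\<Sum>i\<in>bool_cube d. c J i * G i) = 2 ^ d * ((\<Prod>j<d. u j) * (\<Prod>j\<in>J. v j))"
    if "J \<subseteq> {..<d}" for J
  proof -
    \<comment> \<open>Filling up with ones turns the character into a product over all coordinates,
      as \<open>sum_bool_cube_prod\<close> requires.\<close>
    have pJ: "(\<Prod>j\<in>J. f j) = (\<Prod>j<d. if j \<in> J then f j else 1)" for f :: "nat \<Rightarrow> real"
      using that by (simp add: prod.inter_restrict[symmetric] Int_absorb1)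
    have "(\<Sum>i\<in>bool_cube d. c J i * G i) = (\<Sum>i\<in>bool_cube d. \<Prod>j<d.
        (\<lambda>j b. (if j \<in> J then (if b then - 1 else 1) else 1) * (u j * (1 + (if b then - v j else v j)))) j (i j))"
      unfolding c_def G_def pJ by (simp add: prod.distrib)
    also have "\<dots> = (\<Prod>j<d. 2 * (u j * (if j \<in> J then v j else 1)))"
      by (subst sum_bool_cube_prod, intro prod.cong) (auto simp: algebra_simps)
    also have "\<dots> = 2 ^ d * ((\<Prod>j<d. u j) * (\<Prod>j\<in>J. v j))"
      unfolding pJ by (simp add: prod.distrib)
    finally show ?thesis .
  qed
  have key0: "(\<Sum>i\<in>bool_cube d. G i) = 2 ^ d * (\<Prod>j<d. u j)"
    using key[of "{}"] by (simp add: c_def)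
  have "(\<Sum>i\<in>bool_cube d. fgm_density \<theta> d i * G i) =
    (\<Sum>i\<in>bool_cube d. (1/2)^d * (G i + (\<Sum>J\<in>fgm_index_sets d. \<theta> J * (c J i * G i))))"
    by (intro sum.cong refl) (simp add: fgm_density_eq c_def algebra_simps sum_distrib_left)
  also have "\<dots> = (1/2)^d * ((\<Sum>i\<in>bool_cube d. G i) + (\<Sum>J\<in>fgm_index_sets d. \<theta> J * (\<Sum>i\<in>bool_cube d. c J i * G i)))"
    unfolding sum_distrib_left[symmetric] sum.distrib
    by (subst sum.swap) (simp add: sum_distrib_left)
  also have "(\<Sum>J\<in>fgm_index_sets d. \<theta> J * (\<Sum>i\<in>bool_cube d. c J i * G i)) =
     (\<Sum>J\<in>fgm_index_sets d. \<theta> J * (2 ^ d * ((\<Prod>j<d. u j) * (\<Prod>j\<in>J. v j))))"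
    by (intro sum.cong refl arg_cong2[where f="(*)"] key) (auto simp: fgm_index_sets_def)
  also have "\<dots> = 2 ^ d * ((\<Prod>j<d. u j) * (\<Sum>J\<in>fgm_index_sets d. \<theta> J * (\<Prod>j\<in>J. v j)))"
    by (simp add: sum_distrib_left algebra_simps)
  also have "(1/2)^d * ((\<Sum>i\<in>bool_cube d. G i) + \<dots>) =
      (\<Prod>j<d. u j) * (1 + (\<Sum>J\<in>fgm_index_sets d. \<theta> J * (\<Prod>j\<in>J. v j)))"
    unfolding key0 distrib_left mult.assoc[symmetric] power_mult_distrib[symmetric] by simp
  finally show ?thesis
    unfolding G_def .
qed

lemma pmf_fgm_pmf:
  assumes "fgm_valid \<theta> d"
  shows "pmf (fgm_pmf \<theta> d) i = fgm_density \<theta> d i"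
  unfolding fgm_pmf_def
proof (rule pmf_embed_pmf)
  show "0 \<le> fgm_density \<theta> d x" for x by (rule fgm_density_nonneg[OF assms])
  have "(\<integral>\<^sup>+x. ennreal (fgm_density \<theta> d x) \<partial>count_space UNIV) = (\<Sum>i\<in>bool_cube d. ennreal (fgm_density \<theta> d i))"
    by (rule nn_integral_count_space'[OF finite_bool_cube]) (auto simp: fgm_density_outside)
  also have "\<dots> = ennreal (\<Sum>i\<in>bool_cube d. fgm_density \<theta> d i)"
    by (simp add: sum_ennreal fgm_density_nonneg[OF assms])
  \<comment> \<open>With \<open>u = 1\<close> and \<open>v = 0\<close> all factors are 1, so the
    character sum is the total mass; the terms for \<open>J\<close> vanish because \<open>J\<close>
    is nonempty.\<close>
  also have "(\<Sum>i\<in>bool_cube d. fgm_density \<theta> d i) = 1 + (\<Sum>J\<in>fgm_index_sets d. \<theta> J * (\<Prod>j\<in>J. 0))"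
    using sum_fgm_density_prod[of \<theta> d "\<lambda>_. 1" "\<lambda>_. 0"] by (simp cong: if_cong)
  also have "(\<Sum>J\<in>fgm_index_sets d. \<theta> J * (\<Prod>j\<in>J. 0)) = 0"
    by (intro sum.neutral ballI) (auto simp: fgm_index_sets_def)
  finally show "(\<integral>\<^sup>+x. ennreal (fgm_density \<theta> d x) \<partial>count_space UNIV) = 1" by simp
qed

lemma set_pmf_fgm_pmf: "fgm_valid \<theta> d \<Longrightarrow> set_pmf (fgm_pmf \<theta> d) \<subseteq> bool_cube d"
  using fgm_density_outside by (force simp: set_pmf_iff pmf_fgm_pmf)

text \<open>The character sum as an expectation. It yields the joint cdf of the min-max vector as
  well as the success probability of a single bit.\<close>

lemma nn_integral_fgm_pmf_prod:
  fixes u v :: "nat \<Rightarrow> real"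
  assumes valid: "fgm_valid \<theta> d"
    and f: "\<And>i. i \<in> bool_cube d \<Longrightarrow> f i = ennreal (\<Prod>j<d. u j * (1 + (if i j then - v j else v j)))"
    and nn: "\<And>i j. j < d \<Longrightarrow> 0 \<le> u j * (1 + (if i j then - v j else v j))"
  shows "(\<integral>\<^sup>+i. f i \<partial>measure_pmf (fgm_pmf \<theta> d)) =
    ennreal ((\<Prod>j<d. u j) * (1 + (\<Sum>J\<in>fgm_index_sets d. \<theta> J * (\<Prod>j\<in>J. v j))))"
proof -
  have "(\<integral>\<^sup>+i. f i \<partial>measure_pmf (fgm_pmf \<theta> d)) = (\<Sum>i\<in>bool_cube d. f i * ennreal (pmf (fgm_pmf \<theta> d) i))"
    using set_pmf_fgm_pmf[OF valid] by (intro nn_integral_measure_pmf_support finite_bool_cube) auto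
  also have "\<dots> = (\<Sum>i\<in>bool_cube d. ennreal (fgm_density \<theta> d i * (\<Prod>j<d. u j * (1 + (if i j then - v j else v j)))))"
    using f by (intro sum.cong refl) (simp add: pmf_fgm_pmf[OF valid] ennreal_mult' fgm_density_nonneg[OF valid] mult.commute)
  also have "\<dots> = ennreal (\<Sum>i\<in>bool_cube d. fgm_density \<theta> d i * (\<Prod>j<d. u j * (1 + (if i j then - v j else v j))))"
    by (intro sum_ennreal mult_nonneg_nonneg fgm_density_nonneg[OF valid] prod_nonneg ballI nn) simp
  finally show ?thesis unfolding sum_fgm_density_prod .
qed

text \<open>Summing over bit \<open>d\<close> cancels every character containing \<open>d\<close>
  and doubles the others; the factor 2 absorbs the additional 1/2 in the normalisation.\<close>

lemma map_pmf_fgm_pmf_Suc: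
  assumes "fgm_valid \<theta> (Suc d)" "fgm_valid \<theta> d"
  shows "map_pmf (\<lambda>i j. i j \<and> j < d) (fgm_pmf \<theta> (Suc d)) = fgm_pmf \<theta> d"
proof (rule pmf_eqI)
  fix x :: "nat \<Rightarrow> bool"
  let ?g = "\<lambda>(i :: nat \<Rightarrow> bool) j. i j \<and> j < d"
  show "pmf (map_pmf ?g (fgm_pmf \<theta> (Suc d))) x = pmf (fgm_pmf \<theta> d) x"
  proof (cases "x \<in> bool_cube d")
    case False
    then have "?g -` {x} = {}" by (auto simp: bool_cube_def)
    then show ?thesis
      using False by (simp add: pmf_map pmf_fgm_pmf assms fgm_density_outside)
  next
    case True
    then have xd: "\<not> x d" by (auto simp: bool_cube_def)
    have x: "x \<in> bool_cube (Suc d)" "x(d := True) \<in> bool_cube (Suc d)"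
      using True by (auto simp: bool_cube_def)
    \<comment> \<open>Within the cube, truncation at \<open>d\<close> forgets only bit
      \<open>d\<close>, so its fibre over \<open>x\<close> has two points.\<close>
    have eq: "?g -` {x} \<inter> bool_cube (Suc d) = {x, x(d := True)}"
    proof (intro equalityI subsetI)
      fix i assume i: "i \<in> ?g -` {x} \<inter> bool_cube (Suc d)"
      then have x_eq: "x = ?g i" by blast
      have "i j = (x(d := i d)) j" for j
        using i unfolding x_eq bool_cube_def
        by (cases "j < d"; cases "j = d") (auto simp: not_less)
      then have "i = x(d := i d)" ..
      then show "i \<in> {x, x(d := True)}"
        using xd by (metis (full_types) fun_upd_triv insertCI)
    next
      fix i assume i: "i \<in> {x, x(d := True)}"
      have "?g x = x" by (rule bool_cube_truncate[OF True])
      moreover have "?g (x(d := True)) = ?g x" by (rule ext) simp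
      ultimately show "i \<in> ?g -` {x} \<inter> bool_cube (Suc d)"
        using x i by (metis IntI insertE singletonD singletonI vimageI)
    qed
    have "pmf (map_pmf ?g (fgm_pmf \<theta> (Suc d))) x = measure (fgm_pmf \<theta> (Suc d)) (?g -` {x} \<inter> bool_cube (Suc d))"
      unfolding pmf_map using set_pmf_fgm_pmf[OF assms(1)]
      by (intro measure_pmf.finite_measure_eq_AE) (auto simp: AE_measure_pmf_iff)
    also have "\<dots> = fgm_density \<theta> (Suc d) x + fgm_density \<theta> (Suc d) (x(d := True))"
    proof -
      have "x \<noteq> x(d := True)" using xd by (metis fun_upd_same)
      then show ?thesis
        unfolding eq by (simp add: measure_measure_pmf_finite pmf_fgm_pmf assms)
    qed
    also have "\<dots> = (1/2)^Suc d * (2 + (\<Sum>J\<in>fgm_index_sets (Suc d). \<theta> J *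
        ((\<Prod>j\<in>J. if x j then - 1 else 1) + (\<Prod>j\<in>J. if (x(d := True)) j then - 1 else 1))))"
      by (simp add: fgm_density_eq[OF x(1)] fgm_density_eq[OF x(2)] distrib_left sum.distrib del: fun_upd_apply)
    also have "(\<Sum>J\<in>fgm_index_sets (Suc d). \<theta> J *
        ((\<Prod>j\<in>J. if x j then - 1 else 1) + (\<Prod>j\<in>J. if (x(d := True)) j then - 1 else 1))) =
       (\<Sum>J\<in>fgm_index_sets d. 2 * (\<theta> J * (\<Prod>j\<in>J. if x j then - 1 else (1::real))))"
    proof (rule sum.mono_neutral_cong_right)
      show "fgm_index_sets d \<subseteq> fgm_index_sets (Suc d)"
        by (auto simp: fgm_index_sets_def)
      show "\<forall>J\<in>fgm_index_sets (Suc d) - fgm_index_sets d. \<theta> J *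
        ((\<Prod>j\<in>J. if x j then - 1 else 1) + (\<Prod>j\<in>J. if (x(d := True)) j then - 1 else 1)) = 0"
      proof
        fix J assume J: "J \<in> fgm_index_sets (Suc d) - fgm_index_sets d"
        then have d: "d \<in> J" and fin: "finite J"
          by (auto simp: fgm_index_sets_def less_Suc_eq dest: finite_subset)
        have "(\<Prod>j\<in>J. if (x(d := True)) j then - 1 else (1::real)) = - (\<Prod>j\<in>J-{d}. if (x(d := True)) j then - 1 else 1)"
          "(\<Prod>j\<in>J. if x j then - 1 else (1::real)) = (\<Prod>j\<in>J-{d}. if x j then - 1 else 1)"
          using xd by (simp_all add: prod.remove[OF fin d])
        moreover have "(\<Prod>j\<in>J-{d}. if (x(d := True)) j then - 1 else (1::real)) = (\<Prod>j\<in>J-{d}. if x j then - 1 else 1)"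
          by (rule prod.cong) auto
        ultimately have "(\<Prod>j\<in>J. if (x(d := True)) j then - 1 else (1::real)) = - (\<Prod>j\<in>J. if x j then - 1 else 1)"
          by (simp only:)
        then show "\<theta> J * ((\<Prod>j\<in>J. if x j then - 1 else 1) + (\<Prod>j\<in>J. if (x(d := True)) j then - 1 else 1)) = 0"
          by simp
      qed
      fix J assume "J \<in> fgm_index_sets d"
      then have "d \<notin> J" by (auto simp: fgm_index_sets_def)
      then have "(\<Prod>j\<in>J. if (x(d := True)) j then - 1 else 1) = (\<Prod>j\<in>J. if x j then - 1 else (1::real))"
        by (intro prod.cong) auto
      then show "\<theta> J * ((\<Prod>j\<in>J. if x j then - 1 else 1) + (\<Prod>j\<in>J. if (x(d := True)) j then - 1 else 1)) =
        2 * (\<theta> J * (\<Prod>j\<in>J. if x j then - 1 else (1::real)))" by simp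
    qed (rule finite_fgm_index_sets)
    also have "(1/2)^Suc d * (2 + \<dots>) = fgm_density \<theta> d x"
      unfolding fgm_density_eq[OF True] by (simp add: sum_distrib_left[symmetric] distrib_left)
    finally show ?thesis by (simp add: pmf_fgm_pmf assms)
  qed
qed

lemma map_pmf_fgm_pmf:
  assumes "\<And>d. fgm_valid \<theta> d" "d \<le> d'"
  shows "map_pmf (\<lambda>i j. i j \<and> j < d) (fgm_pmf \<theta> d') = fgm_pmf \<theta> d"
  using assms(2)
proof (induction d' rule: dec_induct)
  case base
  have "(\<lambda>j. i j \<and> j < d) = i" if "i \<in> set_pmf (fgm_pmf \<theta> d)" for i
    by (rule bool_cube_truncate, rule subsetD[OF set_pmf_fgm_pmf[OF assms(1)] that])
  then have "map_pmf (\<lambda>i j. i j \<and> j < d) (fgm_pmf \<theta> d) = map_pmf (\<lambda>i. i) (fgm_pmf \<theta> d)"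
    by (rule map_pmf_cong[OF refl])
  then show ?case by (simp only: map_pmf_ident)
next
  case (step n)
  have "map_pmf (\<lambda>i j. i j \<and> j < d) (map_pmf (\<lambda>i j. i j \<and> j < n) (fgm_pmf \<theta> (Suc n))) = fgm_pmf \<theta> d"
    by (simp only: map_pmf_fgm_pmf_Suc[OF assms(1) assms(1)] step.IH)
  moreover have "(\<lambda>i j. i j \<and> j < d) \<circ> (\<lambda>i j. i j \<and> j < n) = (\<lambda>i j. i j \<and> j < d)"
    using step by (auto simp: fun_eq_iff)
  ultimately show ?case by (simp only: pmf.map_comp)
qed

section \<open>Min-max representation of an FGM law\<close>

text \<open>A joint cdf determines the law: the lower orthants are an intersection-stable generator
  of the product sigma-algebra.\<close>

lemma measure_eqI_PiM_atMost:
  fixes P Q :: "('i \<Rightarrow> real) measure"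
  assumes I: "finite I"
    and P: "sets P = sets (PiM I (\<lambda>_. borel))" and Q: "sets Q = sets (PiM I (\<lambda>_. borel))"
    and fin: "finite_measure P"
    and eq: "\<And>y. emeasure P (PiE I (\<lambda>i. {..y i})) = emeasure Q (PiE I (\<lambda>i. {..y i}))"
  shows "P = Q"
proof (rule measure_eqI_generator_eq)
  let ?E = "range (\<lambda>y. PiE I (\<lambda>i. {..y i::real}))" and ?\<Omega> = "PiE I (\<lambda>_. UNIV :: real set)"
  \<comment> \<open>Generating the product sigma-algebra by boxes of half-lines needs a countable
    cover of the line by half-lines; integer endpoints give one.\<close>
  have "\<exists>S\<subseteq>range (\<lambda>a::real. {..a}). countable S \<and> UNIV = \<Union>S"
    by (rule exI[of _ "range (\<lambda>n::nat. {..real n})"]) (auto intro: real_arch_simple)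
  then have "sets (PiM I (\<lambda>_. sigma UNIV (range (\<lambda>a::real. {..a})))) =
      sets (sigma ?\<Omega> {{f \<in> ?\<Omega>. \<forall>i\<in>j. f i \<in> A i} | A j. j \<in> {I} \<and> A \<in> Pi j (\<lambda>_. range (\<lambda>a::real. {..a}))})"
    by (intro sets_PiM_sigma) (use I in auto)
  also have "{{f \<in> ?\<Omega>. \<forall>i\<in>j. f i \<in> A i} | A j. j \<in> {I} \<and> A \<in> Pi j (\<lambda>_. range (\<lambda>a::real. {..a}))} = ?E"
  proof (intro equalityI subsetI)
    fix Z assume "Z \<in> {{f \<in> ?\<Omega>. \<forall>i\<in>j. f i \<in> A i} | A j. j \<in> {I} \<and> A \<in> Pi j (\<lambda>_. range (\<lambda>a::real. {..a}))}"
    then obtain A where A: "A \<in> Pi I (\<lambda>_. range (\<lambda>a::real. {..a}))" and Z: "Z = {f \<in> ?\<Omega>. \<forall>i\<in>I. f i \<in> A i}"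
      by blast
    from A have "\<forall>i\<in>I. \<exists>a. A i = {..a}" by blast
    then obtain y where "\<forall>i\<in>I. A i = {..y i}" by metis
    then have "Z = PiE I (\<lambda>i. {..y i})" unfolding Z by (auto simp: PiE_def Pi_def)
    then show "Z \<in> ?E" by blast
  next
    fix Z assume "Z \<in> ?E"
    then obtain y where Z: "Z = PiE I (\<lambda>i. {..y i})" by blast
    have "Z = {f \<in> ?\<Omega>. \<forall>i\<in>I. f i \<in> (\<lambda>i. {..y i}) i}" unfolding Z by (auto simp: PiE_def Pi_def)
    moreover have "(\<lambda>i. {..y i}) \<in> Pi I (\<lambda>_. range (\<lambda>a::real. {..a}))" by blast
    ultimately show "Z \<in> {{f \<in> ?\<Omega>. \<forall>i\<in>j. f i \<in> A i} | A j. j \<in> {I} \<and> A \<in> Pi j (\<lambda>_. range (\<lambda>a::real. {..a}))}"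
      by (intro CollectI exI[of _ "\<lambda>i. {..y i}"] exI[of _ I] conjI) simp_all
  qed
  finally have *: "sets (PiM I (\<lambda>_. borel :: real measure)) = sigma_sets ?\<Omega> ?E"
    unfolding borel_eq_atMost[symmetric] by (subst (asm) sets_measure_of) (auto simp: PiE_def)
  show "sets P = sigma_sets ?\<Omega> ?E" "sets Q = sigma_sets ?\<Omega> ?E"
    by (simp_all add: P Q *)
  show "Int_stable ?E"
  proof (rule Int_stableI_image)
    fix y y' :: "'i \<Rightarrow> real"
    have "PiE I (\<lambda>i. {..y i}) \<inter> PiE I (\<lambda>i. {..y' i}) = PiE I (\<lambda>i. {..min (y i) (y' i)})"
      by (auto simp: PiE_def Pi_def)
    then show "\<exists>k\<in>UNIV. PiE I (\<lambda>i. {..y i}) \<inter> PiE I (\<lambda>i. {..y' i}) = PiE I (\<lambda>i. {..k i})"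
      by (intro bexI[of _ "\<lambda>i. min (y i) (y' i)"]) auto
  qed
  show "?E \<subseteq> Pow ?\<Omega>" by (auto simp: PiE_def)
  show "emeasure P Z = emeasure Q Z" if "Z \<in> ?E" for Z using that eq by blast
  \<comment> \<open>Orthants with integer bounds cover the space, since finitely many coordinates of
    a point have a common integer bound.\<close>
  show "range (\<lambda>n::nat. PiE I (\<lambda>i. {..real n})) \<subseteq> ?E"
    by (intro image_subsetI) (rule range_eqI, rule refl)
  show "(\<Union>n::nat. PiE I (\<lambda>i. {..real n})) = ?\<Omega>"
  proof (intro equalityI subsetI)
    fix f assume f: "f \<in> ?\<Omega>"
    obtain n where "Max (insert 0 (f ` I)) \<le> real n" using real_arch_simple by blast
    then have "\<forall>i\<in>I. f i \<le> real n" using I by (subst (asm) Max_le_iff) auto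
    then show "f \<in> (\<Union>n::nat. PiE I (\<lambda>i. {..real n}))" using f by (auto simp: PiE_def)
  qed (auto simp: PiE_def)
  show "emeasure P (PiE I (\<lambda>i. {..real n})) \<noteq> \<infinity>" for n
    using finite_measure.emeasure_finite[OF fin] by simp
qed

text \<open>A point of \<open>M \<Otimes>\<^sub>M M\<close> holds two independent draws, so
  \<open>h\<close> at its two components gives iid copies; the bit selects their maximum
  (\<open>True\<close>) or minimum.\<close>

definition minmax :: "('a \<Rightarrow> real) \<Rightarrow> bool \<Rightarrow> 'a \<times> 'a \<Rightarrow> real" where
  "minmax h b p = (if b then max (h (fst p)) (h (snd p)) else min (h (fst p)) (h (snd p)))"

lemma minmax_measurable [measurable]:
  assumes [measurable]: "h \<in> borel_measurable M"
  shows "minmax h b \<in> borel_measurable (M \<Otimes>\<^sub>M M)"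
  unfolding minmax_def by measurable

text \<open>The maximum is at most \<open>y\<close> iff both draws are, with probability F^2; the
  minimum is unless both exceed \<open>y\<close>, with probability 1 - (1 - F)^2. Both are put in
  the form of the factors of the character sum, with \<open>u = F\<close> and
  \<open>v = 1 - F\<close>.\<close>

lemma (in prob_space) prob_minmax_le:
  fixes h :: "'a \<Rightarrow> real" and y :: real
  assumes [measurable]: "h \<in> borel_measurable M"
  defines "F \<equiv> prob {\<omega> \<in> space M. h \<omega> \<le> y}"
  shows "measure (M \<Otimes>\<^sub>M M) {p \<in> space (M \<Otimes>\<^sub>M M). minmax h b p \<le> y} = F * (1 + (if b then - (1 - F) else 1 - F))"
proof -
  interpret MM: pair_prob_space M M ..
  let ?A = "{\<omega> \<in> space M. h \<omega> \<le> y}" and ?B = "{\<omega> \<in> space M. \<not> h \<omega> \<le> y}"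
  have times: "measure (M \<Otimes>\<^sub>M M) (A \<times> A) = prob A * prob A" if "A \<in> sets M" for A
    using that by (simp add: measure_def emeasure_pair_measure_Times enn2real_mult)
  have B: "prob ?B = 1 - F"
    unfolding F_def by (rule prob_neg) simp
  show ?thesis
  proof (cases b)
    case True
    then have "{p \<in> space (M \<Otimes>\<^sub>M M). minmax h b p \<le> y} = ?A \<times> ?A"
      by (auto simp: minmax_def space_pair_measure)
    then show ?thesis
      using True by (simp add: times F_def power2_eq_square)
  next
    case False
    then have "{p \<in> space (M \<Otimes>\<^sub>M M). minmax h b p \<le> y} = space (M \<Otimes>\<^sub>M M) - ?B \<times> ?B"
      by (auto simp: minmax_def space_pair_measure min_le_iff_disj)
    then have "measure (M \<Otimes>\<^sub>M M) {p \<in> space (M \<Otimes>\<^sub>M M). minmax h b p \<le> y} = 1 - prob ?B * prob ?B"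
      by (simp add: MM.prob_compl times)
    then show ?thesis
      using False unfolding B by (simp add: algebra_simps)
  qed
qed

text \<open>Arbitrary \<open>Q\<close> and \<open>K\<close> containing \<open>I\<close> cover both
  the finite Bernoulli vector with finitely many pairs and the infinite sequence.\<close>

lemma minmax_family_measurable:
  fixes H :: "nat \<Rightarrow> 'a \<Rightarrow> real"
  assumes H: "\<And>j. j \<in> I \<Longrightarrow> H j \<in> borel_measurable M"
    and sub: "I \<subseteq> K" and Q: "\<And>j. j \<in> I \<Longrightarrow> (\<lambda>i. i j) \<in> measurable Q (count_space UNIV)"
  shows "(\<lambda>(i, w). \<lambda>j\<in>I. minmax (H j) (i j) (w j))
    \<in> measurable (Q \<Otimes>\<^sub>M PiM K (\<lambda>_. M \<Otimes>\<^sub>M M)) (PiM I (\<lambda>_. borel))"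
  unfolding case_prod_beta
proof (rule measurable_restrict)
  fix j assume j: "j \<in> I"
  then have jK: "j \<in> K" using sub by blast
  show "(\<lambda>x. minmax (H j) (fst x j) (snd x j)) \<in> borel_measurable (Q \<Otimes>\<^sub>M PiM K (\<lambda>_. M \<Otimes>\<^sub>M M))"
  \<comment> \<open>The bit takes countably many values, so measurability may be checked with the
    bit held fixed.\<close>
  proof (rule measurable_compose_countable[where f="\<lambda>b x. minmax (H j) b (snd x j)"])
    have s: "(\<lambda>x. snd x j) \<in> measurable (Q \<Otimes>\<^sub>M PiM K (\<lambda>_. M \<Otimes>\<^sub>M M)) (M \<Otimes>\<^sub>M M)"
      by (rule measurable_compose[OF measurable_snd measurable_component_singleton[OF jK]])
    show "(\<lambda>x. minmax (H j) b (snd x j)) \<in> borel_measurable (Q \<Otimes>\<^sub>M PiM K (\<lambda>_. M \<Otimes>\<^sub>M M))" for b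
      by (rule measurable_compose[OF s minmax_measurable[OF H[OF j]]])
    show "(\<lambda>x. fst x j) \<in> measurable (Q \<Otimes>\<^sub>M PiM K (\<lambda>_. M \<Otimes>\<^sub>M M)) (count_space UNIV)"
      by (rule measurable_compose[OF measurable_fst Q[OF j]])
  qed
qed

text \<open>Both laws have the same joint cdf: given the bits, the selected order statistics are
  independent with the cdfs of \<open>prob_minmax_le\<close>, and averaging over the bits gives the
  copula. The given vector \<open>Y\<close> and the generic copies \<open>H\<close> may live on
  different spaces, as only the margins link them.\<close>

theorem fgm_stochastic_representation:
  fixes H :: "nat \<Rightarrow> 'a \<Rightarrow> real" and Y :: "nat \<Rightarrow> 'b \<Rightarrow> real"
  assumes M: "prob_space M" and R: "prob_space R"
    and H: "\<And>j. j < d \<Longrightarrow> H j \<in> borel_measurable M"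
    and Y: "\<And>j. j < d \<Longrightarrow> Y j \<in> borel_measurable R"
    and valid: "fgm_valid \<theta> d"
    and joint: "\<And>y. measure R {\<omega> \<in> space R. \<forall>j<d. Y j \<omega> \<le> y j} =
       fgm_copula \<theta> d (\<lambda>j. measure M {\<omega> \<in> space M. H j \<omega> \<le> y j})"
  shows "distr R (PiM {..<d} (\<lambda>_. borel)) (\<lambda>\<omega>. \<lambda>j\<in>{..<d}. Y j \<omega>) =
    distr (measure_pmf (fgm_pmf \<theta> d) \<Otimes>\<^sub>M PiM {..<d} (\<lambda>_. M \<Otimes>\<^sub>M M)) (PiM {..<d} (\<lambda>_. borel))
      (\<lambda>(i, w). \<lambda>j\<in>{..<d}. minmax (H j) (i j) (w j))"
proof (rule measure_eqI_PiM_atMost)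
  interpret M: prob_space M by fact
  interpret R: prob_space R by fact
  interpret MM: pair_prob_space M M ..
  interpret W: product_prob_space "\<lambda>_::nat. M \<Otimes>\<^sub>M M" ..
  interpret W': prob_space "PiM {..<d} (\<lambda>_. M \<Otimes>\<^sub>M M)" by (rule prob_space_PiM) (rule MM.prob_space_axioms)
  let ?W = "PiM {..<d} (\<lambda>_. M \<Otimes>\<^sub>M M)" and ?f = "\<lambda>(i, w). \<lambda>j\<in>{..<d}. minmax (H j) (i j) (w j)"
  have mY: "(\<lambda>\<omega>. \<lambda>j\<in>{..<d}. Y j \<omega>) \<in> measurable R (PiM {..<d} (\<lambda>_. borel))"
    by (rule measurable_restrict) (use Y in auto)
  have mf: "?f \<in> measurable (measure_pmf (fgm_pmf \<theta> d) \<Otimes>\<^sub>M ?W) (PiM {..<d} (\<lambda>_. borel))"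
    by (rule minmax_family_measurable) (use H in auto)
  show "finite_measure (distr R (PiM {..<d} (\<lambda>_. borel)) (\<lambda>\<omega>. \<lambda>j\<in>{..<d}. Y j \<omega>))"
    using R.prob_space_distr[OF mY] by (rule prob_space.finite_measure)
  fix y :: "nat \<Rightarrow> real"
  let ?Z = "PiE {..<d} (\<lambda>j. {..y j})"
  define F where "F j = measure M {\<omega> \<in> space M. H j \<omega> \<le> y j}" for j
  have Z: "?Z \<in> sets (PiM {..<d} (\<lambda>_. borel))" by (rule sets_PiM_I_finite) auto
  have "emeasure (distr R (PiM {..<d} (\<lambda>_. borel)) (\<lambda>\<omega>. \<lambda>j\<in>{..<d}. Y j \<omega>)) ?Z =
     emeasure R {\<omega> \<in> space R. \<forall>j<d. Y j \<omega> \<le> y j}"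
  proof -
    have "(\<lambda>\<omega>. \<lambda>j\<in>{..<d}. Y j \<omega>) -` ?Z \<inter> space R = {\<omega> \<in> space R. \<forall>j<d. Y j \<omega> \<le> y j}"
      by (rule set_eqI) (simp add: restrict_PiE_iff Pi_iff Ball_def conj_commute)
    then show ?thesis by (simp only: emeasure_distr[OF mY Z])
  qed
  also have "\<dots> = ennreal (fgm_copula \<theta> d F)"
    unfolding R.emeasure_eq_measure joint F_def[abs_def] ..
  finally have L: "emeasure (distr R (PiM {..<d} (\<lambda>_. borel)) (\<lambda>\<omega>. \<lambda>j\<in>{..<d}. Y j \<omega>)) ?Z = ennreal (fgm_copula \<theta> d F)" .
  let ?S = "?f -` ?Z \<inter> space (measure_pmf (fgm_pmf \<theta> d) \<Otimes>\<^sub>M ?W)"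
  have "emeasure (distr (measure_pmf (fgm_pmf \<theta> d) \<Otimes>\<^sub>M ?W) (PiM {..<d} (\<lambda>_. borel)) ?f) ?Z =
     emeasure (measure_pmf (fgm_pmf \<theta> d) \<Otimes>\<^sub>M ?W) ?S"
    by (rule emeasure_distr[OF mf Z])
  \<comment> \<open>Fubini conditions on the bit vector \<open>i\<close>; each section is a box in
    the product of the pairs, so its measure is a product.\<close>
  also have "\<dots> = (\<integral>\<^sup>+i. emeasure ?W (Pair i -` ?S) \<partial>measure_pmf (fgm_pmf \<theta> d))"
    by (rule W'.emeasure_pair_measure_alt) (rule measurable_sets[OF mf Z])
  also have "\<dots> = ennreal ((\<Prod>j<d. F j) * (1 + (\<Sum>J\<in>fgm_index_sets d. \<theta> J * (\<Prod>j\<in>J. 1 - F j))))"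
  proof (rule nn_integral_fgm_pmf_prod[OF valid])
    have F01: "0 \<le> F j" "F j \<le> 1" for j by (simp_all add: F_def)
    show nn: "0 \<le> F j * (1 + (if i j then - (1 - F j) else 1 - F j))" for i :: "nat \<Rightarrow> bool" and j
      using F01[of j] by (intro mult_nonneg_nonneg) auto
    fix i :: "nat \<Rightarrow> bool"
    let ?P = "\<lambda>j. {p \<in> space (M \<Otimes>\<^sub>M M). minmax (H j) (i j) p \<le> y j}"
    have P: "?P j \<in> sets (M \<Otimes>\<^sub>M M)" if "j < d" for j
      using minmax_measurable[OF H[OF that], of "i j"] by measurable
    have sec: "Pair i -` ?S = PiE {..<d} ?P"
    proof (rule set_eqI)
      fix w
      show "w \<in> Pair i -` ?S \<longleftrightarrow> w \<in> PiE {..<d} ?P"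
        unfolding PiE_iff[of w] space_pair_measure space_PiM
        by (simp add: restrict_PiE_iff Pi_iff PiE_iff[of w]) blast
    qed
    have "emeasure ?W (Pair i -` ?S) = (\<Prod>j<d. emeasure (M \<Otimes>\<^sub>M M) (?P j))"
      unfolding sec by (rule W.emeasure_PiM) (use P in auto)
    also have "\<dots> = (\<Prod>j<d. ennreal (F j * (1 + (if i j then - (1 - F j) else 1 - F j))))"
    proof (rule prod.cong[OF refl])
      fix j assume "j \<in> {..<d}"
      then show "emeasure (M \<Otimes>\<^sub>M M) (?P j) = ennreal (F j * (1 + (if i j then - (1 - F j) else 1 - F j)))"
        unfolding MM.emeasure_eq_measure F_def by (subst M.prob_minmax_le[OF H]) auto
    qed
    also have "\<dots> = ennreal (\<Prod>j<d. F j * (1 + (if i j then - (1 - F j) else 1 - F j)))"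
      by (rule prod_ennreal) (rule nn)
    finally show "emeasure ?W (Pair i -` ?S) = \<dots>" .
  qed
  also have "\<dots> = ennreal (fgm_copula \<theta> d F)" by (simp add: fgm_copula_def)
  finally show "emeasure (distr R (PiM {..<d} (\<lambda>_. borel)) (\<lambda>\<omega>. \<lambda>j\<in>{..<d}. Y j \<omega>)) ?Z =
    emeasure (distr (measure_pmf (fgm_pmf \<theta> d) \<Otimes>\<^sub>M ?W) (PiM {..<d} (\<lambda>_. borel)) ?f) ?Z"
    using L by simp
qed auto

section \<open>Compatible parameters in all dimensions\<close>

lemma fgm_valid_cong:
  "(\<And>J. J \<in> fgm_index_sets d \<Longrightarrow> \<theta> J = \<theta>' J) \<Longrightarrow> fgm_valid \<theta> d \<longleftrightarrow> fgm_valid \<theta>' d"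
  unfolding fgm_valid_def by simp

lemma fgm_copula_cong:
  "(\<And>J. J \<in> fgm_index_sets d \<Longrightarrow> \<theta> J = \<theta>' J) \<Longrightarrow> fgm_copula \<theta> d u = fgm_copula \<theta>' d u"
  unfolding fgm_copula_def by simp

text \<open>Averaging the validity condition over the sign of one coordinate.\<close>
lemma fgm_valid_remove:
  assumes "fgm_valid \<theta> d"
  shows "fgm_valid (\<lambda>J. if r \<in> J then 0 else \<theta> J) d"
  unfolding fgm_valid_def
proof
  fix \<epsilon> :: "nat \<Rightarrow> real" assume \<epsilon>: "\<epsilon> \<in> {..<d} \<rightarrow> {-1, 1}"
  define \<epsilon>' where "\<epsilon>' = \<epsilon>(r := - \<epsilon> r)"
  have \<epsilon>': "\<epsilon>' \<in> {..<d} \<rightarrow> {-1, 1}"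
    using \<epsilon> by (force simp: \<epsilon>'_def Pi_iff)
  \<comment> \<open>Flipping the sign at \<open>r\<close> makes the terms containing
    \<open>r\<close> cancel and doubles the rest.\<close>
  have "\<theta> J * (\<Prod>j\<in>J. \<epsilon> j) + \<theta> J * (\<Prod>j\<in>J. \<epsilon>' j) = 2 * ((if r \<in> J then 0 else \<theta> J) * (\<Prod>j\<in>J. \<epsilon> j))"
    if "J \<in> fgm_index_sets d" for J
  proof (cases "r \<in> J")
    case True
    have fin: "finite J" using that by (auto simp: fgm_index_sets_def dest: finite_subset)
    have "(\<Prod>j\<in>J. \<epsilon>' j) = \<epsilon>' r * (\<Prod>j\<in>J-{r}. \<epsilon>' j)" by (rule prod.remove[OF fin True])
    also have "(\<Prod>j\<in>J-{r}. \<epsilon>' j) = (\<Prod>j\<in>J-{r}. \<epsilon> j)" by (rule prod.cong) (auto simp: \<epsilon>'_def)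
    also have "\<epsilon>' r * \<dots> = - (\<Prod>j\<in>J. \<epsilon> j)" by (simp add: \<epsilon>'_def prod.remove[OF fin True])
    finally show ?thesis using True by simp
  next
    case False
    then have "(\<Prod>j\<in>J. \<epsilon>' j) = (\<Prod>j\<in>J. \<epsilon> j)" by (intro prod.cong) (auto simp: \<epsilon>'_def)
    then show ?thesis using False by simp
  qed
  then have "(\<Sum>J\<in>fgm_index_sets d. \<theta> J * (\<Prod>j\<in>J. \<epsilon> j)) + (\<Sum>J\<in>fgm_index_sets d. \<theta> J * (\<Prod>j\<in>J. \<epsilon>' j)) =
     2 * (\<Sum>J\<in>fgm_index_sets d. (if r \<in> J then 0 else \<theta> J) * (\<Prod>j\<in>J. \<epsilon> j))"
    by (simp add: sum.distrib[symmetric] sum_distrib_left)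
  moreover have "0 \<le> 1 + (\<Sum>J\<in>fgm_index_sets d. \<theta> J * (\<Prod>j\<in>J. \<epsilon> j))"
      "0 \<le> 1 + (\<Sum>J\<in>fgm_index_sets d. \<theta> J * (\<Prod>j\<in>J. \<epsilon>' j))"
    using assms \<epsilon> \<epsilon>' unfolding fgm_valid_def by blast+
  ultimately show "0 \<le> 1 + (\<Sum>J\<in>fgm_index_sets d. (if r \<in> J then 0 else \<theta> J) * (\<Prod>j\<in>J. \<epsilon> j))"
    by linarith
qed

text \<open>The finitely many coordinates below \<open>d\<close> and outside \<open>D\<close> are
  averaged out one after the other; \<open>R\<close> collects those already removed.\<close>

lemma fgm_valid_restrict:
  assumes "fgm_valid \<theta> d"
  shows "fgm_valid (\<lambda>J. if J \<subseteq> D then \<theta> J else 0) d"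
proof -
  have "fgm_valid (\<lambda>J. if J \<inter> R = {} then \<theta> J else 0) d" if "finite R" for R
    using that
  proof induction
    case empty
    then show ?case using assms by simp
  next
    case (insert r R)
    have "(\<lambda>J. if r \<in> J then 0 else if J \<inter> R = {} then \<theta> J else 0) = (\<lambda>J. if J \<inter> insert r R = {} then \<theta> J else 0)"
      by (rule ext) auto
    with fgm_valid_remove[OF insert.IH, of r] show ?case by simp
  qed
  from this[of "{..<d} - D"] have "fgm_valid (\<lambda>J. if J \<inter> ({..<d} - D) = {} then \<theta> J else 0) d" by simp
  moreover have "J \<inter> ({..<d} - D) = {} \<longleftrightarrow> J \<subseteq> D" if "J \<in> fgm_index_sets d" for J
    using that by (auto simp: fgm_index_sets_def)
  ultimately show ?thesis
    by (subst (asm) fgm_valid_cong[where \<theta>'="\<lambda>J. if J \<subseteq> D then \<theta> J else 0"]) auto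
qed

text \<open>A coordinate with value 0 annihilates the leading product, and one with value 1
  annihilates every term whose index set contains it. Coefficients involving a degenerate coordinate
  are therefore invisible.\<close>

lemma fgm_copula_restrict:
  assumes u: "\<And>j. j < d \<Longrightarrow> j \<notin> D \<Longrightarrow> u j = 0 \<or> u j = 1"
  shows "fgm_copula (\<lambda>J. if J \<subseteq> D then \<theta> J else 0) d u = fgm_copula \<theta> d u"
proof (cases "\<exists>j<d. u j = 0")
  case True
  then have "(\<Prod>j<d. u j) = 0" by auto
  then show ?thesis by (simp add: fgm_copula_def)
next
  case False
  have "(\<Prod>j\<in>J. 1 - u j) = 0" if J: "J \<in> fgm_index_sets d" "\<not> J \<subseteq> D" for J
  proof -
    obtain j where j: "j \<in> J" "j \<notin> D" using J by auto
    moreover have "finite J" "j < d" using J j by (auto simp: fgm_index_sets_def dest: finite_subset)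
    ultimately show ?thesis using False u by (intro prod_zero) auto
  qed
  then have "(\<Sum>J\<in>fgm_index_sets d. (if J \<subseteq> D then \<theta> J else 0) * (\<Prod>j\<in>J. 1 - u j)) =
     (\<Sum>J\<in>fgm_index_sets d. \<theta> J * (\<Prod>j\<in>J. 1 - u j))"
    by (intro sum.cong) auto
  then show ?thesis by (simp add: fgm_copula_def)
qed

text \<open>Arguments equal to 1 remove every \<open>J\<close> not contained in \<open>T\<close>.
  The right-hand side is free of \<open>d\<close>, which makes copulas of different dimensions
  comparable.\<close>

lemma fgm_copula_margin:
  assumes T: "T \<subseteq> {..<d}"
  shows "fgm_copula \<theta> d (\<lambda>j. if j \<in> T then u j else 1) =
    (\<Prod>j\<in>T. u j) * (1 + (\<Sum>J | J \<subseteq> T \<and> 2 \<le> card J. \<theta> J * (\<Prod>j\<in>J. 1 - u j)))"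
proof -
  have "(\<Prod>j<d. if j \<in> T then u j else 1) = (\<Prod>j\<in>T. u j)"
    using T by (simp add: prod.inter_restrict[symmetric] Int_absorb1)
  moreover have "(\<Sum>J\<in>fgm_index_sets d. \<theta> J * (\<Prod>j\<in>J. 1 - (if j \<in> T then u j else 1))) =
      (\<Sum>J | J \<subseteq> T \<and> 2 \<le> card J. \<theta> J * (\<Prod>j\<in>J. 1 - u j))"
  proof (rule sum.mono_neutral_cong_right)
    show "{J. J \<subseteq> T \<and> 2 \<le> card J} \<subseteq> fgm_index_sets d" using T by (auto simp: fgm_index_sets_def)
    show "\<forall>J\<in>fgm_index_sets d - {J. J \<subseteq> T \<and> 2 \<le> card J}. \<theta> J * (\<Prod>j\<in>J. 1 - (if j \<in> T then u j else 1)) = 0"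
    proof
      fix J assume J: "J \<in> fgm_index_sets d - {J. J \<subseteq> T \<and> 2 \<le> card J}"
      then have "finite J" "\<exists>j\<in>J. j \<notin> T"
        by (auto simp: fgm_index_sets_def dest: finite_subset)
      then have "(\<Prod>j\<in>J. 1 - (if j \<in> T then u j else 1)) = 0" by (intro prod_zero) auto
      then show "\<theta> J * (\<Prod>j\<in>J. 1 - (if j \<in> T then u j else 1)) = 0" by simp
    qed
    fix J assume "J \<in> {J. J \<subseteq> T \<and> 2 \<le> card J}"
    then have "(\<Prod>j\<in>J. 1 - (if j \<in> T then u j else 1)) = (\<Prod>j\<in>J. 1 - u j)"
      by (intro prod.cong) auto
    then show "\<theta> J * (\<Prod>j\<in>J. 1 - (if j \<in> T then u j else 1)) = \<theta> J * (\<Prod>j\<in>J. 1 - u j)" by simp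
  qed (rule finite_fgm_index_sets)
  ultimately show ?thesis by (simp add: fgm_copula_def)
qed

text \<open>The condition of \<open>fgm_rep\<close> with all coordinates on the same footing, so
  that the claim count needs no separate treatment.\<close>

definition fgm_joint :: "'a measure \<Rightarrow> (nat \<Rightarrow> 'a \<Rightarrow> real) \<Rightarrow> nat \<Rightarrow> (nat set \<Rightarrow> real) \<Rightarrow> bool" where
  "fgm_joint M Y d \<theta> \<longleftrightarrow> fgm_valid \<theta> d \<and>
     (\<forall>y. measure M {\<omega> \<in> space M. \<forall>j<d. Y j \<omega> \<le> y j} =
        fgm_copula \<theta> d (\<lambda>j. measure M {\<omega> \<in> space M. Y j \<omega> \<le> y j}))"

section \<open>Marginal laws, uniqueness and compatibility of the coefficients\<close>

context prob_space
begin

text \<open>\<open>fgm_joint\<close> only speaks of finite thresholds; a marginal is reached by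
  letting the thresholds outside \<open>T\<close> tend to infinity.\<close>

lemma prob_le_tendsto_finite:
  fixes Y :: "nat \<Rightarrow> 'a \<Rightarrow> real"
  assumes [measurable]: "\<And>j. j < d \<Longrightarrow> Y j \<in> borel_measurable M"
  shows "(\<lambda>n. prob {\<omega> \<in> space M. \<forall>j<d. Y j \<omega> \<le> (if j \<in> T then y j else real n)})
     \<longlonglongrightarrow> prob {\<omega> \<in> space M. \<forall>j<d. j \<in> T \<longrightarrow> Y j \<omega> \<le> y j}"
proof -
  let ?A = "\<lambda>n. {\<omega> \<in> space M. \<forall>j<d. Y j \<omega> \<le> (if j \<in> T then y j else real n)}"
  have "range ?A \<subseteq> events"
  proof (intro image_subsetI)
    fix n
    have "?A n = {\<omega> \<in> space M. \<forall>j\<in>{..<d}. Y j \<omega> \<le> (if j \<in> T then y j else real n)}" by auto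
    also have "\<dots> \<in> events" by (rule sets.sets_Collect_finite_All) auto
    finally show "?A n \<in> events" .
  qed
  moreover have "incseq ?A"
  proof (rule incseq_SucI, rule Collect_mono, intro impI conjI allI)
    fix n \<omega> j assume *: "\<omega> \<in> space M \<and> (\<forall>j<d. Y j \<omega> \<le> (if j \<in> T then y j else real n))"
    then show "\<omega> \<in> space M" by simp
    assume "j < d"
    with * have "Y j \<omega> \<le> (if j \<in> T then y j else real n)" by blast
    then show "Y j \<omega> \<le> (if j \<in> T then y j else real (Suc n))" by (cases "j \<in> T") auto
  qed
  ultimately have "(\<lambda>n. prob (?A n)) \<longlonglongrightarrow> prob (\<Union>n. ?A n)"
    by (rule finite_Lim_measure_incseq)
  also have "(\<Union>n. ?A n) = {\<omega> \<in> space M. \<forall>j<d. j \<in> T \<longrightarrow> Y j \<omega> \<le> y j}"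
  proof (intro equalityI subsetI)
    fix \<omega> assume \<omega>: "\<omega> \<in> {\<omega> \<in> space M. \<forall>j<d. j \<in> T \<longrightarrow> Y j \<omega> \<le> y j}"
    obtain n where "Max (insert 0 ((\<lambda>j. Y j \<omega>) ` {..<d})) \<le> real n" using real_arch_simple by blast
    then have "\<forall>j<d. Y j \<omega> \<le> real n" by (subst (asm) Max_le_iff) auto
    then show "\<omega> \<in> (\<Union>n. ?A n)" using \<omega> by auto
  qed (auto split: if_splits)
  finally show ?thesis .
qed

text \<open>The copula is a polynomial in its arguments, hence continuous, so the joint identity
  survives the limit in which the cdf values outside \<open>T\<close> tend to 1.\<close>

lemma fgm_joint_margin:
  assumes Y: "\<And>j. j < d \<Longrightarrow> Y j \<in> borel_measurable M" and joint: "fgm_joint M Y d \<theta>"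
  shows "prob {\<omega> \<in> space M. \<forall>j<d. j \<in> T \<longrightarrow> Y j \<omega> \<le> y j} =
    fgm_copula \<theta> d (\<lambda>j. if j \<in> T then prob {\<omega> \<in> space M. Y j \<omega> \<le> y j} else 1)"
proof -
  let ?u = "\<lambda>n j. prob {\<omega> \<in> space M. Y j \<omega> \<le> (if j \<in> T then y j else real n)}"
  let ?v = "\<lambda>j. if j \<in> T then prob {\<omega> \<in> space M. Y j \<omega> \<le> y j} else 1"
  have u: "(\<lambda>n. ?u n j) \<longlonglongrightarrow> ?v j" if "j < d" for j
  proof (cases "j \<in> T")
    case False
    \<comment> \<open>The limit of a single cdf is the limit lemma for a vector of length 1 with
      \<open>T = {}\<close>.\<close>
    have "(\<lambda>n. prob {\<omega> \<in> space M. \<forall>i<(1::nat). Y j \<omega> \<le> (if i \<in> {} then 0 else real n)})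
       \<longlonglongrightarrow> prob {\<omega> \<in> space M. \<forall>i<(1::nat). i \<in> {} \<longrightarrow> Y j \<omega> \<le> 0}"
      by (rule prob_le_tendsto_finite) (rule Y[OF that])
    then show ?thesis using False by (simp add: prob_space)
  qed simp
  have "(\<lambda>n. fgm_copula \<theta> d (?u n)) \<longlonglongrightarrow> fgm_copula \<theta> d ?v"
    unfolding fgm_copula_def
    by (intro tendsto_intros u) (auto simp: fgm_index_sets_def)
  moreover have "fgm_copula \<theta> d (?u n) = prob {\<omega> \<in> space M. \<forall>j<d. Y j \<omega> \<le> (if j \<in> T then y j else real n)}" for n
    using joint[unfolded fgm_joint_def, THEN conjunct2, rule_format, of "\<lambda>j. if j \<in> T then y j else real n"] by simp
  ultimately show ?thesis
    using LIMSEQ_unique[OF prob_le_tendsto_finite[where d=d and Y=Y and T=T and y=y, OF Y]] by simp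
qed

text \<open>Compare the margins on \<open>J\<close> at a point where all cdf values lie strictly
  between 0 and 1. Proper subsets agree by induction, and what remains is an equation for the
  coefficient of \<open>J\<close> with a nonzero factor.\<close>

lemma fgm_joint_unique:
  assumes Y: "\<And>j. Y j \<in> borel_measurable M"
    and joint: "fgm_joint M Y d \<theta>" "fgm_joint M Y d' \<theta>'"
    and J: "finite J" "J \<subseteq> {..<d}" "J \<subseteq> {..<d'}" "2 \<le> card J"
    and nondeg: "\<And>j. j \<in> J \<Longrightarrow> \<exists>y. 0 < prob {\<omega> \<in> space M. Y j \<omega> \<le> y} \<and> prob {\<omega> \<in> space M. Y j \<omega> \<le> y} < 1"
  shows "\<theta> J = \<theta>' J"
  using J nondeg
proof (induction J rule: finite_psubset_induct)
  case (psubset J)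
  obtain y where y: "\<And>j. j \<in> J \<Longrightarrow> 0 < prob {\<omega> \<in> space M. Y j \<omega> \<le> y j} \<and> prob {\<omega> \<in> space M. Y j \<omega> \<le> y j} < 1"
    using psubset.prems(4) by metis
  define u where "u j = prob {\<omega> \<in> space M. Y j \<omega> \<le> y j}" for j
  let ?S = "{K. K \<subseteq> J \<and> 2 \<le> card K}"
  have S: "finite ?S" "J \<in> ?S" using psubset by auto
  have "{\<omega> \<in> space M. \<forall>j<d. j \<in> J \<longrightarrow> Y j \<omega> \<le> y j} = {\<omega> \<in> space M. \<forall>j<d'. j \<in> J \<longrightarrow> Y j \<omega> \<le> y j}"
    using psubset.prems by auto
  then have "fgm_copula \<theta> d (\<lambda>j. if j \<in> J then u j else 1) = fgm_copula \<theta>' d' (\<lambda>j. if j \<in> J then u j else 1)"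
    unfolding u_def by (simp add: fgm_joint_margin[OF Y joint(1), symmetric] fgm_joint_margin[OF Y joint(2), symmetric])
  then have "(\<Prod>j\<in>J. u j) * (1 + (\<Sum>K\<in>?S. \<theta> K * (\<Prod>j\<in>K. 1 - u j))) =
      (\<Prod>j\<in>J. u j) * (1 + (\<Sum>K\<in>?S. \<theta>' K * (\<Prod>j\<in>K. 1 - u j)))"
    using psubset.prems by (simp add: fgm_copula_margin)
  moreover have "(\<Prod>j\<in>J. u j) \<noteq> 0"
    using y psubset.hyps by (force simp: u_def)
  ultimately have "(\<Sum>K\<in>?S. \<theta> K * (\<Prod>j\<in>K. 1 - u j)) = (\<Sum>K\<in>?S. \<theta>' K * (\<Prod>j\<in>K. 1 - u j))"
    by simp
  moreover have "(\<Sum>K\<in>?S - {J}. \<theta> K * (\<Prod>j\<in>K. 1 - u j)) = (\<Sum>K\<in>?S - {J}. \<theta>' K * (\<Prod>j\<in>K. 1 - u j))"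
  proof (rule sum.cong[OF refl])
    fix K assume "K \<in> ?S - {J}"
    then have "\<theta> K = \<theta>' K" using psubset.prems by (intro psubset.IH) auto
    then show "\<theta> K * (\<Prod>j\<in>K. 1 - u j) = \<theta>' K * (\<Prod>j\<in>K. 1 - u j)" by simp
  qed
  ultimately have "\<theta> J * (\<Prod>j\<in>J. 1 - u j) = \<theta>' J * (\<Prod>j\<in>J. 1 - u j)"
    by (simp add: sum.remove[OF S])
  moreover have "(\<Prod>j\<in>J. 1 - u j) \<noteq> 0"
    using y psubset.hyps by (force simp: u_def)
  ultimately show ?case by simp
qed

text \<open>A coefficient is determined by the joint law only if all of its coordinates are
  nondegenerate; setting the other ones to 0 makes the copulas of all dimensions compatible.\<close>
lemma fgm_joint_compatible:
  assumes Y: "\<And>j. Y j \<in> borel_measurable M"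
    and ex: "\<And>k. k \<in> L \<Longrightarrow> \<exists>\<theta>. fgm_joint M Y (Suc k) \<theta>"
    and down: "\<And>k l. k \<in> L \<Longrightarrow> l \<le> k \<Longrightarrow> l \<in> L"
  obtains \<Theta> where "\<And>d. fgm_valid \<Theta> d" "\<And>k. k \<in> L \<Longrightarrow> fgm_joint M Y (Suc k) \<Theta>"
proof -
  obtain t where t: "\<And>k. k \<in> L \<Longrightarrow> fgm_joint M Y (Suc k) (t k)" using ex by metis
  let ?F = "\<lambda>j y. prob {\<omega> \<in> space M. Y j \<omega> \<le> y}"
  define D where "D = {j. \<exists>y. 0 < ?F j y \<and> ?F j y < 1}"
  \<comment> \<open>\<open>Max J\<close> is the least \<open>k\<close> for which \<open>J\<close> is
    an index set of dimension \<open>Suc k\<close>; by uniqueness any larger \<open>k\<close> in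
    \<open>L\<close> gives the same value when \<open>J \<subseteq> D\<close>.\<close>
  define \<Theta> where "\<Theta> J = (if J \<subseteq> D \<and> Max J \<in> L then t (Max J) J else 0)" for J
  have \<Theta>: "\<Theta> J = (if J \<subseteq> D then t k J else 0)" if k: "k \<in> L" and J: "J \<in> fgm_index_sets (Suc k)" for k J
  proof (cases "J \<subseteq> D")
    case True
    have J': "finite J" "J \<noteq> {}" "2 \<le> card J" "J \<subseteq> {..<Suc k}"
      using J by (auto simp: fgm_index_sets_def dest: finite_subset)
    then have "Max J \<le> k" by (auto simp: less_Suc_eq_le)
    then have m: "Max J \<in> L" using down k by blast
    have "t (Max J) J = t k J"
      using True J' by (intro fgm_joint_unique[OF Y t[OF m] t[OF k]]) (auto simp: D_def less_Suc_eq_le)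
    then show ?thesis using True m by (simp add: \<Theta>_def)
  qed (simp add: \<Theta>_def)
  have valid: "fgm_valid \<Theta> (Suc k)" if "k \<in> L" for k
    using fgm_valid_cong[of "Suc k", OF \<Theta>[OF that]] fgm_valid_restrict t[OF that] by (simp add: fgm_joint_def)
  have "fgm_joint M Y (Suc k) \<Theta>" if k: "k \<in> L" for k
    unfolding fgm_joint_def
  proof (intro conjI allI valid k)
    fix y
    have "?F j (y j) = 0 \<or> ?F j (y j) = 1" if "j \<notin> D" for j
      using that by (auto simp: D_def) (metis measure_nonneg order_le_imp_less_or_eq prob_le_1)
    then have "fgm_copula (\<lambda>J. if J \<subseteq> D then t k J else 0) (Suc k) (\<lambda>j. ?F j (y j)) =
        fgm_copula (t k) (Suc k) (\<lambda>j. ?F j (y j))"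
      by (rule fgm_copula_restrict)
    with fgm_copula_cong[of "Suc k", OF \<Theta>[OF k]]
    have "fgm_copula \<Theta> (Suc k) (\<lambda>j. ?F j (y j)) = fgm_copula (t k) (Suc k) (\<lambda>j. ?F j (y j))"
      by simp
    then show "prob {\<omega> \<in> space M. \<forall>j<Suc k. Y j \<omega> \<le> y j} = fgm_copula \<Theta> (Suc k) (\<lambda>j. ?F j (y j))"
      using t[OF k] by (simp add: fgm_joint_def)
  qed
  \<comment> \<open>Validity is also needed beyond a bounded \<open>L\<close>, for an infinite
    sequence. Nonzero coefficients have their maximum in \<open>L\<close>, so the sum reduces to the
    one for the largest \<open>k\<close> in \<open>L\<close> below \<open>d\<close>.\<close>
  moreover have "fgm_valid \<Theta> d" for d
  proof -
    have max_L: "Max J \<in> L \<inter> {..<d}" if "J \<in> fgm_index_sets d" "\<Theta> J \<noteq> 0" for J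
    proof -
      have "finite J" "J \<noteq> {}" "J \<subseteq> {..<d}"
        using that by (auto simp: fgm_index_sets_def dest: finite_subset)
      then have "Max J \<in> {..<d}" using Max_in by blast
      then show ?thesis using that by (auto simp: \<Theta>_def split: if_splits)
    qed
    show ?thesis
    proof (cases "L \<inter> {..<d} = {}")
      case True
      then have "fgm_valid \<Theta> d \<longleftrightarrow> fgm_valid (\<lambda>_. 0) d"
        using max_L by (intro fgm_valid_cong) auto
      then show ?thesis by (simp add: fgm_valid_def)
    next
      case False
      define k where "k = Max (L \<inter> {..<d})"
      have k: "k \<in> L" "k < d" using Max_in[of "L \<inter> {..<d}"] False by (auto simp: k_def)
      have eq: "(\<Sum>J\<in>fgm_index_sets d. \<Theta> J * (\<Prod>j\<in>J. \<epsilon> j)) = (\<Sum>J\<in>fgm_index_sets (Suc k). \<Theta> J * (\<Prod>j\<in>J. \<epsilon> j))" for \<epsilon>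
      proof (rule sum.mono_neutral_right)
        show "fgm_index_sets (Suc k) \<subseteq> fgm_index_sets d" using k by (auto simp: fgm_index_sets_def)
        show "\<forall>J\<in>fgm_index_sets d - fgm_index_sets (Suc k). \<Theta> J * (\<Prod>j\<in>J. \<epsilon> j) = 0"
        proof (rule ballI, rule ccontr)
          fix J assume J: "J \<in> fgm_index_sets d - fgm_index_sets (Suc k)" "\<Theta> J * (\<Prod>j\<in>J. \<epsilon> j) \<noteq> 0"
          then have "Max J \<le> k" using max_L[of J] unfolding k_def by (intro Max_ge) auto
          moreover have "finite J" using J by (auto simp: fgm_index_sets_def dest: finite_subset)
          ultimately have "J \<subseteq> {..<Suc k}" by (auto simp: less_Suc_eq_le intro: order_trans[OF Max_ge])
          then show False using J by (auto simp: fgm_index_sets_def)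
        qed
      qed (rule finite_fgm_index_sets)
      show ?thesis
        unfolding fgm_valid_def eq
      proof
        fix \<epsilon> :: "nat \<Rightarrow> real" assume "\<epsilon> \<in> {..<d} \<rightarrow> {-1, 1}"
        then have "\<epsilon> \<in> {..<Suc k} \<rightarrow> {-1, 1}" using k by (auto simp: Pi_iff)
        then show "0 \<le> 1 + (\<Sum>J\<in>fgm_index_sets (Suc k). \<Theta> J * (\<Prod>j\<in>J. \<epsilon> j))"
          using valid[OF k(1)] unfolding fgm_valid_def by blast
      qed
    qed
  qed
  ultimately show thesis using that by blast
qed

end

section \<open>The Bernoulli sequence\<close>

text \<open>The indicator of bit \<open>j\<close> is a product of the required form:
  \<open>u = 1/2\<close>, \<open>v = -1\<close> at \<open>j\<close> give the factor 1 or 0, and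
  \<open>u = 1\<close>, \<open>v = 0\<close> elsewhere give 1. Each \<open>J\<close> has two
  elements, hence one with \<open>v = 0\<close>, so only 1/2 remains.\<close>

lemma measure_fgm_pmf_component:
  assumes valid: "fgm_valid \<theta> d" and j: "j < d"
  shows "measure (measure_pmf (fgm_pmf \<theta> d)) {i. i j} = 1 / 2"
proof -
  let ?u = "\<lambda>m. if m = j then 1 / 2 else (1::real)" and ?v = "\<lambda>m. if m = j then - 1 else (0::real)"
  have pv: "(\<Prod>m\<in>J. ?v m) = 0" if J: "J \<in> fgm_index_sets d" for J
  proof -
    have fin: "finite J" using J by (auto simp: fgm_index_sets_def dest: finite_subset)
    have "\<not> J \<subseteq> {j}" using J card_mono[of "{j}" J] by (auto simp: fgm_index_sets_def)
    then show ?thesis using fin by (intro prod_zero) auto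
  qed
  have "emeasure (measure_pmf (fgm_pmf \<theta> d)) {i. i j} = (\<integral>\<^sup>+i. indicator {i. i j} i \<partial>measure_pmf (fgm_pmf \<theta> d))"
    by simp
  also have "\<dots> = ennreal ((\<Prod>m<d. ?u m) * (1 + (\<Sum>J\<in>fgm_index_sets d. \<theta> J * (\<Prod>m\<in>J. ?v m))))"
  proof (rule nn_integral_fgm_pmf_prod[OF valid])
    fix i :: "nat \<Rightarrow> bool"
    have "(\<Prod>m<d. ?u m * (1 + (if i m then - ?v m else ?v m))) = (\<Prod>m<d. if m = j then of_bool (i j) else 1)"
      by (rule prod.cong) auto
    also have "\<dots> = of_bool (i j)" using j by simp
    finally show "indicator {i. i j} i = ennreal (\<Prod>m<d. ?u m * (1 + (if i m then - ?v m else ?v m)))"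
      by (simp add: indicator_def)
  qed auto
  also have "(\<Prod>m<d. ?u m) = 1 / 2" using j by simp
  also have "(\<Sum>J\<in>fgm_index_sets d. \<theta> J * (\<Prod>m\<in>J. ?v m)) = 0"
    by (intro sum.neutral ballI) (simp only: pv mult_zero_right)
  finally have "emeasure (measure_pmf (fgm_pmf \<theta> d)) {i. i j} = ennreal (1 / 2)" by simp
  then show ?thesis by (simp only: measure_def enn2real_ennreal)
qed

text \<open>A map reading only the first \<open>d\<close> bits has the same law in every larger
  dimension, by consistency of the Bernoulli vectors.\<close>

lemma distr_fgm_pmf_truncate:
  assumes valid: "\<And>d. fgm_valid \<theta> d" and "d \<le> d'"
    and f: "\<And>i. f i \<in> space N" "\<And>i. f (\<lambda>j. i j \<and> j < d) = f i"
  shows "distr (measure_pmf (fgm_pmf \<theta> d')) N f = distr (measure_pmf (fgm_pmf \<theta> d)) N f"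
proof -
  have "distr (measure_pmf (fgm_pmf \<theta> d)) N f =
      distr (distr (measure_pmf (fgm_pmf \<theta> d')) (count_space UNIV) (\<lambda>i j. i j \<and> j < d)) N f"
    unfolding map_pmf_fgm_pmf[OF valid \<open>d \<le> d'\<close>, symmetric] map_pmf_rep_eq ..
  also have "\<dots> = distr (measure_pmf (fgm_pmf \<theta> d')) N (f \<circ> (\<lambda>i j. i j \<and> j < d))"
    by (rule distr_distr) (use f in auto)
  also have "f \<circ> (\<lambda>i j. i j \<and> j < d) = f"
    by (rule ext) (simp only: comp_apply f(2))
  finally show ?thesis ..
qed

text \<open>Kolmogorov's extension theorem is available for Polish spaces, hence the
  detour through real-valued sequences.\<close>
lemma ex_fgm_sequence:
  assumes valid: "\<And>d. fgm_valid \<theta> d"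
  obtains Q :: "(nat \<Rightarrow> bool) measure" where "prob_space Q"
    and "sets Q = sets (PiM UNIV (\<lambda>_. count_space UNIV))"
    and "\<And>d. distr Q (PiM {..<d} (\<lambda>_. count_space UNIV)) (\<lambda>i. restrict i {..<d}) =
      distr (measure_pmf (fgm_pmf \<theta> d)) (PiM {..<d} (\<lambda>_. count_space UNIV)) (\<lambda>i. restrict i {..<d})"
proof -
  \<comment> \<open>A dimension large enough to contain all indices in \<open>J\<close>; the
    inserted 0 handles the empty set.\<close>
  define N where "N J = Suc (Max (insert 0 J))" for J :: "nat set"
  define emb :: "nat set \<Rightarrow> (nat \<Rightarrow> bool) \<Rightarrow> nat \<Rightarrow> real" where "emb J i = (\<lambda>j\<in>J. of_bool (i j))" for J i
  define P where "P J = distr (measure_pmf (fgm_pmf \<theta> (N J))) (PiM J (\<lambda>_. borel)) (emb J)" for J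
  have emb: "emb J i \<in> space (PiM J (\<lambda>_. borel))" for J i
    by (simp add: emb_def space_PiM)
  have lt_N: "j < N J" if "finite J" "j \<in> J" for j J
    using that by (simp add: N_def less_Suc_eq_le)
  have P_eq: "P J = distr (measure_pmf (fgm_pmf \<theta> d)) (PiM J (\<lambda>_. borel)) (emb J)"
    if "finite J" "N J \<le> d" for J d
    unfolding P_def
  proof (rule distr_fgm_pmf_truncate[OF valid that(2) emb, symmetric])
    fix i :: "nat \<Rightarrow> bool"
    show "emb J (\<lambda>j. i j \<and> j < N J) = emb J i"
      unfolding emb_def by (rule restrict_ext) (simp add: lt_N[OF that(1)])
  qed
  interpret PF: polish_projective UNIV P
  proof (rule polish_projective.intro, rule projective_family.intro)
    fix J H :: "nat set" assume JH: "J \<subseteq> H" "finite H"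
    then have J: "finite J" by (rule finite_subset)
    have "N J \<le> N H" unfolding N_def using JH by (intro Suc_leI le_imp_less_Suc Max_mono) auto
    have "distr (P H) (PiM J (\<lambda>_. borel)) (\<lambda>f. restrict f J) =
        distr (measure_pmf (fgm_pmf \<theta> (N H))) (PiM J (\<lambda>_. borel)) ((\<lambda>f. restrict f J) \<circ> emb H)"
      unfolding P_def by (rule distr_distr) (use JH emb in \<open>auto intro!: measurable_restrict_subset\<close>)
    also have "(\<lambda>f. restrict f J) \<circ> emb H = emb J"
      unfolding emb_def comp_def using JH by (intro ext) (auto simp: restrict_def)
    also have "distr (measure_pmf (fgm_pmf \<theta> (N H))) (PiM J (\<lambda>_. borel)) (emb J) = P J"
      by (rule P_eq[symmetric]) fact+
    finally show "P J = distr (P H) (PiM J (\<lambda>_. borel)) (\<lambda>f. restrict f J)" ..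
  next
    fix J :: "nat set"
    show "prob_space (P J)"
      unfolding P_def by (rule measure_pmf.prob_space_distr) (use emb in auto)
  qed
  \<comment> \<open>Bits were embedded as 0 and 1, so the threshold 1/2 recovers them.\<close>
  let ?g = "\<lambda>(x::nat \<Rightarrow> real) j. 1 / 2 < x j"
  let ?B = "\<lambda>J::nat set. PiM J (\<lambda>_. count_space (UNIV :: bool set))"
  have g: "?g \<in> measurable PF.lim (?B UNIV)"
  proof (rule measurable_PiM_single')
    fix j
    have "(\<lambda>x. x j) \<in> borel_measurable (PiM UNIV (\<lambda>_::nat. borel :: real measure))"
      by (rule measurable_component_singleton) simp
    then have "(\<lambda>x. 1 / 2 < x j) \<in> measurable (PiM UNIV (\<lambda>_::nat. borel :: real measure)) (count_space UNIV)"
      by measurable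
    then show "(\<lambda>x. 1 / 2 < x j) \<in> measurable PF.lim (count_space UNIV)"
      by (simp only: measurable_cong_sets[OF PF.sets_lim refl])
  qed auto
  show thesis
  proof
    show "prob_space (distr PF.lim (?B UNIV) ?g)" by (rule PF.P.prob_space_distr[OF g])
    show "sets (distr PF.lim (?B UNIV) ?g) = sets (?B UNIV)" by simp
    fix d :: nat
    let ?J = "{..<d}"
    have marg: "distr PF.lim (PiM ?J (\<lambda>_. borel)) (\<lambda>x. restrict x ?J) = P ?J"
    proof (rule measure_eqI)
      show "sets (distr PF.lim (PiM ?J (\<lambda>_. borel)) (\<lambda>x. restrict x ?J)) = sets (P ?J)" by (simp add: P_def)
      fix A assume "A \<in> sets (distr PF.lim (PiM ?J (\<lambda>_. borel)) (\<lambda>x. restrict x ?J))"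
      then have A: "A \<in> sets (PiM ?J (\<lambda>_. borel))" by simp
      show "emeasure (distr PF.lim (PiM ?J (\<lambda>_. borel)) (\<lambda>x. restrict x ?J)) A = emeasure (P ?J) A"
        unfolding emeasure_distr_restrict[OF subset_UNIV PF.sets_lim A]
        by (rule PF.emeasure_lim_emb) (use A in auto)
    qed
    have r: "(\<lambda>x. restrict x ?J) \<in> measurable PF.lim (PiM ?J (\<lambda>_. borel))"
      unfolding measurable_cong_sets[OF PF.sets_lim refl] by (rule measurable_restrict_subset) simp
    have h: "(\<lambda>x. restrict (?g x) ?J) \<in> measurable (PiM ?J (\<lambda>_. borel)) (?B ?J)"
    proof (rule measurable_restrict)
      fix j assume "j \<in> ?J"
      then have "(\<lambda>x. x j) \<in> borel_measurable (PiM ?J (\<lambda>_. borel :: real measure))"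
        by (rule measurable_component_singleton)
      then show "(\<lambda>x. 1 / 2 < x j) \<in> measurable (PiM ?J (\<lambda>_. borel :: real measure)) (count_space UNIV)"
        by measurable
    qed
    have "distr (distr PF.lim (?B UNIV) ?g) (?B ?J) (\<lambda>i. restrict i ?J) =
        distr PF.lim (?B ?J) ((\<lambda>i. restrict i ?J) \<circ> ?g)"
      by (rule distr_distr[OF _ g]) (rule measurable_restrict_subset, simp)
    \<comment> \<open>Decoding acts coordinatewise and commutes with restriction, which reduces the
      marginal of \<open>Q\<close> to the known finite marginal of the limit.\<close>
    also have "(\<lambda>i. restrict i ?J) \<circ> ?g = (\<lambda>x. restrict (?g x) ?J) \<circ> (\<lambda>x. restrict x ?J)"
      by (rule ext) (simp add: comp_def cong: restrict_cong)
    also have "distr PF.lim (?B ?J) \<dots> = distr (P ?J) (?B ?J) (\<lambda>x. restrict (?g x) ?J)"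
      unfolding marg[symmetric] by (rule distr_distr[OF h r, symmetric])
    also have "\<dots> = distr (measure_pmf (fgm_pmf \<theta> (N ?J))) (?B ?J) ((\<lambda>x. restrict (?g x) ?J) \<circ> emb ?J)"
      unfolding P_def by (rule distr_distr[OF h]) (use emb in auto)
    also have "(\<lambda>x. restrict (?g x) ?J) \<circ> emb ?J = (\<lambda>i. restrict i ?J)"
      unfolding comp_def emb_def by (intro ext restrict_ext) simp
    also have "distr (measure_pmf (fgm_pmf \<theta> (N ?J))) (?B ?J) (\<lambda>i. restrict i ?J) =
        distr (measure_pmf (fgm_pmf \<theta> d)) (?B ?J) (\<lambda>i. restrict i ?J)"
    proof (rule distr_fgm_pmf_truncate[OF valid])
      show "d \<le> N ?J" using lt_N[of ?J "d - 1"] by (cases d) auto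
      show "restrict i ?J \<in> space (?B ?J)" for i :: "nat \<Rightarrow> bool" by (simp add: space_PiM)
      show "restrict (\<lambda>j. i j \<and> j < d) ?J = restrict i ?J" for i :: "nat \<Rightarrow> bool"
        by (rule restrict_ext) simp
    qed
    finally show "distr (distr PF.lim (?B UNIV) ?g) (?B ?J) (\<lambda>i. restrict i ?J) =
        distr (measure_pmf (fgm_pmf \<theta> d)) (?B ?J) (\<lambda>i. restrict i ?J)" .
  qed
qed

section \<open>Random sums\<close>

text \<open>The map reads only coordinates in \<open>I\<close>, so bits and pairs may be replaced by
  their marginals on \<open>I\<close>. This gives the finite vector and the infinite sequence a
  common form.\<close>

lemma minmax_family_distr_restrict:
  fixes H :: "nat \<Rightarrow> 'a \<Rightarrow> real" and A :: "(nat \<Rightarrow> bool) measure"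
  assumes M: "prob_space M" and A: "prob_space A"
    and H: "\<And>j. j \<in> I \<Longrightarrow> H j \<in> borel_measurable M"
    and I: "finite I" "I \<subseteq> K"
    and comp: "\<And>j. j \<in> I \<Longrightarrow> (\<lambda>i. i j) \<in> measurable A (count_space UNIV)"
  shows "distr (A \<Otimes>\<^sub>M PiM K (\<lambda>_. M \<Otimes>\<^sub>M M)) (PiM I (\<lambda>_. borel)) (\<lambda>(i, w). \<lambda>j\<in>I. minmax (H j) (i j) (w j)) =
    distr (distr A (PiM I (\<lambda>_. count_space UNIV)) (\<lambda>i. restrict i I) \<Otimes>\<^sub>M PiM I (\<lambda>_. M \<Otimes>\<^sub>M M))
      (PiM I (\<lambda>_. borel)) (\<lambda>(i, w). \<lambda>j\<in>I. minmax (H j) (i j) (w j))"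
proof -
  interpret M: prob_space M by fact
  interpret MM: pair_prob_space M M ..
  interpret W: product_prob_space "\<lambda>_::nat. M \<Otimes>\<^sub>M M" K ..
  let ?B = "PiM I (\<lambda>_. count_space (UNIV :: bool set))" and ?W = "\<lambda>K::nat set. PiM K (\<lambda>_. M \<Otimes>\<^sub>M M)"
  let ?G = "PiM I (\<lambda>_. borel :: real measure)" and ?f = "\<lambda>(i, w). \<lambda>j\<in>I. minmax (H j) (i j) (w j)"
  let ?r = "\<lambda>(i :: nat \<Rightarrow> bool, w :: nat \<Rightarrow> 'a \<times> 'a). (restrict i I, restrict w I)"
  have rA: "(\<lambda>i. restrict i I) \<in> measurable A ?B"
    by (rule measurable_restrict) (rule comp)
  have rW: "(\<lambda>w. restrict w I) \<in> measurable (?W K) (?W I)"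
    by (rule measurable_restrict_subset) fact
  have W_eq: "distr (?W K) (?W I) (\<lambda>w. restrict w I) = ?W I"
    by (rule W.distr_PiM_restrict_finite[OF I])
  have "prob_space (?W I)" by (rule prob_space_PiM) (rule MM.prob_space_axioms)
  then have pair: "distr A ?B (\<lambda>i. restrict i I) \<Otimes>\<^sub>M ?W I = distr (A \<Otimes>\<^sub>M ?W K) (?B \<Otimes>\<^sub>M ?W I) ?r"
    using pair_measure_distr[OF rA rW] unfolding W_eq by (simp add: prob_space_imp_sigma_finite)
  have f: "?f \<in> measurable (?B \<Otimes>\<^sub>M ?W I) ?G"
    by (rule minmax_family_measurable[OF H]) (auto intro: measurable_component_singleton)
  have r: "?r \<in> measurable (A \<Otimes>\<^sub>M ?W K) (?B \<Otimes>\<^sub>M ?W I)"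
    unfolding case_prod_beta
    by (intro measurable_Pair measurable_compose[OF measurable_fst rA] measurable_compose[OF measurable_snd rW])
  have "distr (distr A ?B (\<lambda>i. restrict i I) \<Otimes>\<^sub>M ?W I) ?G ?f = distr (A \<Otimes>\<^sub>M ?W K) ?G (?f \<circ> ?r)"
    unfolding pair by (rule distr_distr[OF f r])
  also have "?f \<circ> ?r = ?f"
    by (rule ext) (simp add: case_prod_beta cong: restrict_cong)
  finally show ?thesis ..
qed

lemma measurable_random_sum:
  fixes V :: "nat \<Rightarrow> 'a \<Rightarrow> real"
  assumes N: "N \<in> measurable M (count_space UNIV)" and V: "\<And>j. 1 \<le> j \<Longrightarrow> V j \<in> borel_measurable M"
  shows "(\<lambda>\<omega>. \<Sum>j\<in>{1..N \<omega>}. V j \<omega>) \<in> borel_measurable M"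
  by (rule measurable_compose_countable[where f="\<lambda>n \<omega>. \<Sum>j\<in>{1..n}. V j \<omega>", OF _ N])
    (rule borel_measurable_sum, use V in auto)

lemma emeasure_random_sum:
  fixes V :: "nat \<Rightarrow> 'a \<Rightarrow> real"
  assumes N: "N \<in> measurable M (count_space UNIV)" and V: "\<And>j. 1 \<le> j \<Longrightarrow> V j \<in> borel_measurable M"
    and B: "B \<in> sets borel"
  shows "emeasure (distr M borel (\<lambda>\<omega>. \<Sum>j\<in>{1..N \<omega>}. V j \<omega>)) B =
    (\<Sum>n. emeasure M {\<omega> \<in> space M. N \<omega> = n \<and> (\<Sum>j\<in>{1..n}. V j \<omega>) \<in> B})"
proof -
  let ?A = "\<lambda>n. {\<omega> \<in> space M. N \<omega> = n \<and> (\<Sum>j\<in>{1..n}. V j \<omega>) \<in> B}"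
  have "?A n \<in> sets M" for n
  proof -
    have "(\<lambda>\<omega>. \<Sum>j\<in>{1..n}. V j \<omega>) \<in> borel_measurable M"
      by (rule borel_measurable_sum) (use V in auto)
    from measurable_sets[OF this B] measurable_sets[OF N, of "{n}"]
    have "(N -` {n} \<inter> space M) \<inter> ((\<lambda>\<omega>. \<Sum>j\<in>{1..n}. V j \<omega>) -` B \<inter> space M) \<in> sets M" by auto
    also have "(N -` {n} \<inter> space M) \<inter> ((\<lambda>\<omega>. \<Sum>j\<in>{1..n}. V j \<omega>) -` B \<inter> space M) = ?A n" by auto
    finally show ?thesis .
  qed
  then have "(\<Sum>n. emeasure M (?A n)) = emeasure M (\<Union>n. ?A n)"
    by (intro suminf_emeasure) (auto simp: disjoint_family_on_def)
  also have "(\<Union>n. ?A n) = (\<lambda>\<omega>. \<Sum>j\<in>{1..N \<omega>}. V j \<omega>) -` B \<inter> space M" by auto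
  finally show ?thesis
    by (simp only: emeasure_distr[OF measurable_random_sum[OF N V] B])
qed

text \<open>The law of the count and the first \<open>k\<close> summands already decides this event.
  Keeping \<open>n\<close> and \<open>k\<close> independent allows \<open>k = 0\<close>, where only
  the count is observed.\<close>

lemma emeasure_count_sum_slice:
  fixes V :: "nat \<Rightarrow> 'a \<Rightarrow> real"
  assumes N: "N \<in> measurable M (count_space UNIV)" and V: "\<And>j. 1 \<le> j \<Longrightarrow> V j \<in> borel_measurable M"
    and B: "B \<in> sets borel"
  shows "emeasure M {\<omega> \<in> space M. N \<omega> = n \<and> (\<Sum>j\<in>{1..k}. V j \<omega>) \<in> B} =
    emeasure (distr M (PiM {..<Suc k} (\<lambda>_. borel)) (\<lambda>\<omega>. \<lambda>j\<in>{..<Suc k}. if j = 0 then real (N \<omega>) else V j \<omega>))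
      {x \<in> space (PiM {..<Suc k} (\<lambda>_. borel)). x 0 = real n \<and> (\<Sum>j\<in>{1..k}. x j) \<in> B}"
proof -
  let ?f = "\<lambda>\<omega>. \<lambda>j\<in>{..<Suc k}. if j = 0 then real (N \<omega>) else V j \<omega>"
  let ?P = "PiM {..<Suc k} (\<lambda>_::nat. borel :: real measure)"
  let ?E = "{x \<in> space ?P. x 0 = real n \<and> (\<Sum>j\<in>{1..k}. x j) \<in> B}"
  have f: "?f \<in> measurable M ?P"
  proof (rule measurable_restrict)
    fix j
    have "(\<lambda>\<omega>. real (N \<omega>)) \<in> borel_measurable M"
      by (rule measurable_compose[OF N]) simp
    then show "(\<lambda>\<omega>. if j = 0 then real (N \<omega>) else V j \<omega>) \<in> borel_measurable M"
      using V[of j] by (cases "j = 0") auto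
  qed
  have c: "(\<lambda>x. x j) \<in> borel_measurable ?P" if "j \<in> {..<Suc k}" for j
    using that by (rule measurable_component_singleton)
  have "(\<lambda>x. \<Sum>j\<in>{1..k}. x j) \<in> borel_measurable ?P"
    by (rule borel_measurable_sum) (rule c, auto)
  from measurable_sets[OF this B] measurable_sets[OF c[of 0], of "{real n}"]
  have "((\<lambda>x. x 0) -` {real n} \<inter> space ?P) \<inter> ((\<lambda>x. \<Sum>j\<in>{1..k}. x j) -` B \<inter> space ?P) \<in> sets ?P" by auto
  also have "((\<lambda>x. x 0) -` {real n} \<inter> space ?P) \<inter> ((\<lambda>x. \<Sum>j\<in>{1..k}. x j) -` B \<inter> space ?P) = ?E" by auto
  finally have E: "?E \<in> sets ?P" .
  have "?f -` ?E \<inter> space M = {\<omega> \<in> space M. N \<omega> = n \<and> (\<Sum>j\<in>{1..k}. V j \<omega>) \<in> B}"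
  proof (rule set_eqI)
    fix \<omega>
    have "(\<Sum>j\<in>{1..k}. ?f \<omega> j) = (\<Sum>j\<in>{1..k}. V j \<omega>)"
      by (rule sum.cong) auto
    then show "\<omega> \<in> ?f -` ?E \<inter> space M \<longleftrightarrow> \<omega> \<in> {\<omega> \<in> space M. N \<omega> = n \<and> (\<Sum>j\<in>{1..k}. V j \<omega>) \<in> B}"
      by (auto simp: space_PiM)
  qed
  then show ?thesis by (simp only: emeasure_distr[OF f E])
qed

text \<open>When the count is \<open>n\<close>, only the first \<open>n\<close> summands matter, so
  equality of the finite-dimensional laws suffices for \<open>n\<close> in \<open>L\<close>; other
  values of the count are null on both sides.\<close>

lemma distr_random_sum_cong:
  fixes V :: "nat \<Rightarrow> 'a \<Rightarrow> real" and V' :: "nat \<Rightarrow> 'b \<Rightarrow> real"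
  assumes N: "N \<in> measurable M (count_space UNIV)" and V: "\<And>j. 1 \<le> j \<Longrightarrow> V j \<in> borel_measurable M"
    and N': "N' \<in> measurable M' (count_space UNIV)" and V': "\<And>j. 1 \<le> j \<Longrightarrow> V' j \<in> borel_measurable M'"
    and eq: "\<And>n. n \<in> L \<Longrightarrow>
      distr M (PiM {..<Suc n} (\<lambda>_. borel)) (\<lambda>\<omega>. \<lambda>j\<in>{..<Suc n}. if j = 0 then real (N \<omega>) else V j \<omega>) =
      distr M' (PiM {..<Suc n} (\<lambda>_. borel)) (\<lambda>\<omega>. \<lambda>j\<in>{..<Suc n}. if j = 0 then real (N' \<omega>) else V' j \<omega>)"
    and L: "0 \<in> L" "\<And>n. n \<notin> L \<Longrightarrow> emeasure M {\<omega> \<in> space M. N \<omega> = n} = 0"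
  shows "distr M borel (\<lambda>\<omega>. \<Sum>j\<in>{1..N \<omega>}. V j \<omega>) = distr M' borel (\<lambda>\<omega>. \<Sum>j\<in>{1..N' \<omega>}. V' j \<omega>)"
proof (rule measure_eqI)
  fix B assume "B \<in> sets (distr M borel (\<lambda>\<omega>. \<Sum>j\<in>{1..N \<omega>}. V j \<omega>))"
  then have B: "B \<in> sets borel" by simp
  have slice: "emeasure M {\<omega> \<in> space M. N \<omega> = n \<and> (\<Sum>j\<in>{1..k}. V j \<omega>) \<in> B} =
      emeasure M' {\<omega> \<in> space M'. N' \<omega> = n \<and> (\<Sum>j\<in>{1..k}. V' j \<omega>) \<in> B}"
    if k: "k \<in> L" and B: "B \<in> sets borel" for n k B
    by (simp only: emeasure_count_sum_slice[OF N V B] emeasure_count_sum_slice[OF N' V' B] eq[OF k])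
  have "emeasure M {\<omega> \<in> space M. N \<omega> = n \<and> (\<Sum>j\<in>{1..n}. V j \<omega>) \<in> B} =
      emeasure M' {\<omega> \<in> space M'. N' \<omega> = n \<and> (\<Sum>j\<in>{1..n}. V' j \<omega>) \<in> B}" for n
  proof (cases "n \<in> L")
    case False
    \<comment> \<open>The nullity passes to \<open>M'\<close> because the slice with
      \<open>k = 0\<close> and \<open>B = UNIV\<close> equates the laws of the counts.\<close>
    have z: "emeasure M {\<omega> \<in> space M. N \<omega> = n} = 0" "emeasure M' {\<omega> \<in> space M'. N' \<omega> = n} = 0"
      using L(2)[OF False] slice[OF L(1), of UNIV n] by auto
    have s: "{\<omega> \<in> space M. N \<omega> = n} \<in> sets M" "{\<omega> \<in> space M'. N' \<omega> = n} \<in> sets M'"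
      using N N' by measurable
    have "emeasure M {\<omega> \<in> space M. N \<omega> = n \<and> (\<Sum>j\<in>{1..n}. V j \<omega>) \<in> B} = 0"
      by (rule emeasure_eq_0[OF s(1) z(1)]) auto
    moreover have "emeasure M' {\<omega> \<in> space M'. N' \<omega> = n \<and> (\<Sum>j\<in>{1..n}. V' j \<omega>) \<in> B} = 0"
      by (rule emeasure_eq_0[OF s(2) z(2)]) auto
    ultimately show ?thesis by simp
  qed (rule slice[OF _ B])
  then show "emeasure (distr M borel (\<lambda>\<omega>. \<Sum>j\<in>{1..N \<omega>}. V j \<omega>)) B =
      emeasure (distr M' borel (\<lambda>\<omega>. \<Sum>j\<in>{1..N' \<omega>}. V' j \<omega>)) B"
    by (simp only: emeasure_random_sum[OF N V B] emeasure_random_sum[OF N' V' B])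
qed simp

section \<open>Collective risk models\<close>

definition crm_coord :: "('a \<Rightarrow> nat) \<Rightarrow> (nat \<Rightarrow> 'a \<Rightarrow> real) \<Rightarrow> nat \<Rightarrow> 'a \<Rightarrow> real" where
  "crm_coord N X j \<omega> = (if j = 0 then real (N \<omega>) else X j \<omega>)"

text \<open>The variable whose iid copies enter position \<open>j\<close>: every claim position uses
  copies of \<open>X 1\<close>, since the claims share one law.\<close>

definition crm_generic :: "('a \<Rightarrow> nat) \<Rightarrow> (nat \<Rightarrow> 'a \<Rightarrow> real) \<Rightarrow> nat \<Rightarrow> 'a \<Rightarrow> real" where
  "crm_generic N X j \<omega> = (if j = 0 then real (N \<omega>) else X 1 \<omega>)"

lemma crmD:
  assumes "crm M N X"
  shows "prob_space M" "N \<in> measurable M (count_space UNIV)"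
    and "1 \<le> j \<Longrightarrow> X j \<in> borel_measurable M"
    and "1 \<le> j \<Longrightarrow> distr M borel (X j) = distr M borel (X 1)"
  using assms unfolding crm_def by blast+

lemma crm_coord_measurable:
  assumes "crm M N X"
  shows "crm_coord N X j \<in> borel_measurable M"
proof (cases "j = 0")
  case True
  have "(\<lambda>\<omega>. real (N \<omega>)) \<in> borel_measurable M" by (rule measurable_compose[OF crmD(2)[OF assms]]) simp
  then show ?thesis using True by (simp add: crm_coord_def[abs_def])
next
  case False
  then show ?thesis using crmD(3)[OF assms, of j] by (simp add: crm_coord_def[abs_def])
qed

lemma crm_generic_eq: "crm_generic N X j = crm_coord N X (if j = 0 then 0 else 1)"
  by (rule ext) (simp add: crm_coord_def crm_generic_def)

lemma crm_generic_measurable: "crm M N X \<Longrightarrow> crm_generic N X j \<in> borel_measurable M"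
  unfolding crm_generic_eq by (rule crm_coord_measurable)

lemma measure_crm_coord_le:
  assumes crm: "crm M N X"
  shows "measure M {\<omega> \<in> space M. crm_coord N X j \<omega> \<le> y} = measure M {\<omega> \<in> space M. crm_generic N X j \<omega> \<le> y}"
proof (cases "j = 0")
  case False
  have X: "X j \<in> borel_measurable M" "X 1 \<in> borel_measurable M" "distr M borel (X j) = distr M borel (X 1)"
    using False by (intro crmD[OF crm], simp)+
  have pre: "f -` {..y} \<inter> space M = {\<omega> \<in> space M. f \<omega> \<le> y}" for f :: "'a \<Rightarrow> real" by auto
  have "measure M {\<omega> \<in> space M. X j \<omega> \<le> y} = measure (distr M borel (X j)) {..y}"
    by (simp add: measure_distr[OF X(1)] pre)
  also have "\<dots> = measure M {\<omega> \<in> space M. X 1 \<omega> \<le> y}"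
    unfolding X(3) by (subst measure_distr[OF X(2)]) (simp_all only: pre, simp)
  finally show ?thesis using False by (simp add: crm_coord_def crm_generic_def)
qed (simp add: crm_coord_def crm_generic_def)

lemma fgm_rep_iff_fgm_joint:
  assumes crm: "crm M N X"
  shows "fgm_rep M N X k \<theta> \<longleftrightarrow> fgm_joint M (crm_coord N X) (Suc k) \<theta>"
proof -
  have cdf: "measure M {\<omega> \<in> space M. crm_coord N X j \<omega> \<le> y} = (if j = 0 then cdf_N M N y else cdf_X M X y)" for j y
    unfolding measure_crm_coord_le[OF crm] by (simp add: crm_generic_def cdf_N_def cdf_X_def)
  have ev: "{\<omega> \<in> space M. \<forall>j<Suc k. crm_coord N X j \<omega> \<le> y j} =
      {\<omega> \<in> space M. real (N \<omega>) \<le> y 0 \<and> (\<forall>j\<in>{1..k}. X j \<omega> \<le> y j)}" for y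
  proof -
    have "(\<forall>j<Suc k. crm_coord N X j \<omega> \<le> y j) \<longleftrightarrow> real (N \<omega>) \<le> y 0 \<and> (\<forall>j\<in>{1..k}. X j \<omega> \<le> y j)" for \<omega>
    proof
      assume *: "\<forall>j<Suc k. crm_coord N X j \<omega> \<le> y j"
      then have "crm_coord N X 0 \<omega> \<le> y 0" by blast
      moreover have "X j \<omega> \<le> y j" if "j \<in> {1..k}" for j
        using *[rule_format, of j] that by (simp add: crm_coord_def)
      ultimately show "real (N \<omega>) \<le> y 0 \<and> (\<forall>j\<in>{1..k}. X j \<omega> \<le> y j)" by (simp add: crm_coord_def)
    qed (auto simp: crm_coord_def)
    then show ?thesis by simp
  qed
  \<comment> \<open>\<open>fgm_rep\<close> has a separate threshold \<open>n\<close> for the count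
    and ignores \<open>x 0\<close>; storing \<open>n\<close> at index 0 translates between the two
    forms.\<close>
  have "(\<forall>y. measure M {\<omega> \<in> space M. real (N \<omega>) \<le> y 0 \<and> (\<forall>j\<in>{1..k}. X j \<omega> \<le> y j)} =
        fgm_copula \<theta> (Suc k) (\<lambda>j. if j = 0 then cdf_N M N (y j) else cdf_X M X (y j))) \<longleftrightarrow>
     (\<forall>n x. measure M {\<omega> \<in> space M. real (N \<omega>) \<le> n \<and> (\<forall>j\<in>{1..k}. X j \<omega> \<le> x j)} =
        fgm_copula \<theta> (Suc k) (\<lambda>m. if m = 0 then cdf_N M N n else cdf_X M X (x m)))" (is "?L \<longleftrightarrow> ?R")
  proof
    assume ?L
    show ?R
    proof (intro allI)
      fix n :: real and x :: "nat \<Rightarrow> real"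
      have "(\<lambda>j. if j = 0 then cdf_N M N ((x(0 := n)) j) else cdf_X M X ((x(0 := n)) j)) =
          (\<lambda>m. if m = 0 then cdf_N M N n else cdf_X M X (x m))" by (rule ext) simp
      moreover have "(\<forall>j\<in>{1..k}. X j \<omega> \<le> (x(0 := n)) j) \<longleftrightarrow> (\<forall>j\<in>{1..k}. X j \<omega> \<le> x j)" for \<omega>
        by (rule ball_cong) auto
      ultimately show "measure M {\<omega> \<in> space M. real (N \<omega>) \<le> n \<and> (\<forall>j\<in>{1..k}. X j \<omega> \<le> x j)} =
        fgm_copula \<theta> (Suc k) (\<lambda>m. if m = 0 then cdf_N M N n else cdf_X M X (x m))"
        using \<open>?L\<close>[rule_format, of "x(0 := n)"] by (simp only: fun_upd_same)
    qed
  next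
    assume ?R
    show ?L
    proof
      fix y :: "nat \<Rightarrow> real"
      have "(\<lambda>j. if j = 0 then cdf_N M N (y j) else cdf_X M X (y j)) =
          (\<lambda>m. if m = 0 then cdf_N M N (y 0) else cdf_X M X (y m))" by (rule ext) simp
      then show "measure M {\<omega> \<in> space M. real (N \<omega>) \<le> y 0 \<and> (\<forall>j\<in>{1..k}. X j \<omega> \<le> y j)} =
        fgm_copula \<theta> (Suc k) (\<lambda>j. if j = 0 then cdf_N M N (y j) else cdf_X M X (y j))"
        using \<open>?R\<close> by (simp only:)
    qed
  qed
  then show ?thesis
    unfolding fgm_rep_def fgm_joint_def cdf ev by (rule arg_cong[symmetric])
qed

text \<open>No subset of a singleton has two elements, so the copula is the identity. This supplies
  \<open>k = 0\<close>, on which \<open>aleph_FGM\<close> is silent.\<close>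

lemma fgm_joint_1: "fgm_joint M Y (Suc 0) \<theta>"
proof -
  have "J \<notin> fgm_index_sets (Suc 0)" for J
  proof
    assume "J \<in> fgm_index_sets (Suc 0)"
    then have "J \<subseteq> {..<Suc 0}" "2 \<le> card J" by (simp_all add: fgm_index_sets_def)
    then show False using card_mono[of "{..<Suc 0}" J] by simp
  qed
  then have "fgm_index_sets (Suc 0) = {}" by blast
  then show ?thesis
    by (simp add: fgm_joint_def fgm_valid_def fgm_copula_def)
qed

lemma crm_stochastic_representation:
  assumes crm: "crm M N X" and joint: "fgm_joint M (crm_coord N X) d \<theta>"
  shows "distr M (PiM {..<d} (\<lambda>_. borel)) (\<lambda>\<omega>. \<lambda>j\<in>{..<d}. crm_coord N X j \<omega>) =
    distr (measure_pmf (fgm_pmf \<theta> d) \<Otimes>\<^sub>M PiM {..<d} (\<lambda>_. M \<Otimes>\<^sub>M M)) (PiM {..<d} (\<lambda>_. borel))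
      (\<lambda>(i, w). \<lambda>j\<in>{..<d}. minmax (crm_generic N X j) (i j) (w j))"
proof (rule fgm_stochastic_representation)
  show "prob_space M" "prob_space M" by (rule crmD[OF crm])+
  show "fgm_valid \<theta> d" using joint by (simp add: fgm_joint_def)
  show "measure M {\<omega> \<in> space M. \<forall>j<d. crm_coord N X j \<omega> \<le> y j} =
      fgm_copula \<theta> d (\<lambda>j. measure M {\<omega> \<in> space M. crm_generic N X j \<omega> \<le> y j})" for y
    using joint by (simp only: fgm_joint_def measure_crm_coord_le[OF crm])
qed (rule crm_generic_measurable[OF crm] crm_coord_measurable[OF crm])+

lemma minmax_crm_generic_0:
  "minmax (crm_generic N X 0) b p = real (if b then max (N (fst p)) (N (snd p)) else min (N (fst p)) (N (snd p)))"
  by (simp add: minmax_def crm_generic_def of_nat_max of_nat_min)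

lemma minmax_crm_generic_pos:
  "j \<noteq> 0 \<Longrightarrow> minmax (crm_generic N X j) b p =
     (1 - of_bool b) * min (X 1 (fst p)) (X 1 (snd p)) + of_bool b * max (X 1 (fst p)) (X 1 (snd p))"
  by (simp add: minmax_def crm_generic_def)

text \<open>For each \<open>n\<close> in \<open>L\<close>, the count and the first \<open>n\<close>
  claims have the law of their min-max counterparts built from \<open>Q\<close>, because
  \<open>Q\<close> has the right marginal on the first \<open>Suc n\<close> bits; the comparison of
  random sums does the rest.\<close>

lemma aggregate_representation:
  assumes crm: "crm M N X" and Q: "prob_space Q" and sQ: "sets Q = sets (PiM UNIV (\<lambda>_. count_space UNIV))"
    and marg: "\<And>d. distr Q (PiM {..<d} (\<lambda>_. count_space UNIV)) (\<lambda>i. restrict i {..<d}) =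
      distr (measure_pmf (fgm_pmf \<theta> d)) (PiM {..<d} (\<lambda>_. count_space UNIV)) (\<lambda>i. restrict i {..<d})"
    and joint: "\<And>k. k \<in> L \<Longrightarrow> fgm_joint M (crm_coord N X) (Suc k) \<theta>"
    and L: "0 \<in> L" "\<And>n. n \<notin> L \<Longrightarrow> emeasure M {\<omega> \<in> space M. N \<omega> = n} = 0"
  shows "distr M borel (aggregate N X) =
    distr (Q \<Otimes>\<^sub>M PiM UNIV (\<lambda>_::nat. M \<Otimes>\<^sub>M M)) borel
      (\<lambda>(i, w). \<Sum>j\<in>{1..if i 0 then max (N (fst (w 0))) (N (snd (w 0))) else min (N (fst (w 0))) (N (snd (w 0)))}.
         minmax (crm_generic N X j) (i j) (w j))"
proof -
  let ?R = "Q \<Otimes>\<^sub>M PiM UNIV (\<lambda>_::nat. M \<Otimes>\<^sub>M M)"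
  let ?N = "\<lambda>(i, w). if i (0::nat) then max (N (fst (w (0::nat)))) (N (snd (w 0))) else min (N (fst (w 0))) (N (snd (w 0)))"
  let ?V = "\<lambda>j (i, w). minmax (crm_generic N X j) (i j) (w j)"
  have M: "prob_space M" and N: "N \<in> measurable M (count_space UNIV)" and X: "\<And>j. 1 \<le> j \<Longrightarrow> X j \<in> borel_measurable M"
    by (auto intro: crmD[OF crm])
  have comp: "(\<lambda>i. i j) \<in> measurable Q (count_space UNIV)" for j
    unfolding measurable_cong_sets[OF sQ refl] by (rule measurable_component_singleton) simp
  have V: "?V j \<in> borel_measurable ?R" for j
  proof -
    \<comment> \<open>A single component is read off the family over the singleton index
      set.\<close>
    have "(\<lambda>(i, w). \<lambda>j\<in>{j}. minmax (crm_generic N X j) (i j) (w j)) \<in> measurable ?R (PiM {j} (\<lambda>_. borel))"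
      by (rule minmax_family_measurable) (auto intro: comp crm_generic_measurable[OF crm])
    from measurable_compose[OF this measurable_component_singleton[of j]] show ?thesis
      by (simp add: case_prod_beta)
  qed
  have mN: "?N \<in> measurable ?R (count_space UNIV)"
  proof -
    \<comment> \<open>The represented count is an integer-valued real at position 0; taking the
      floor transfers its measurability to the natural numbers.\<close>
    have "(\<lambda>x. nat \<lfloor>?V 0 x\<rfloor>) \<in> measurable ?R (count_space UNIV)"
      by (rule measurable_compose[OF V]) measurable
    also have "(\<lambda>x. nat \<lfloor>?V 0 x\<rfloor>) = ?N"
      by (rule ext) (simp add: case_prod_beta minmax_crm_generic_0)
    finally show ?thesis .
  qed
  have "distr M borel (\<lambda>\<omega>. \<Sum>j\<in>{1..N \<omega>}. X j \<omega>) = distr ?R borel (\<lambda>x. \<Sum>j\<in>{1..?N x}. ?V j x)"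
  proof (rule distr_random_sum_cong[where L=L and N'="?N" and V'="?V"])
    show "N \<in> measurable M (count_space UNIV)" "?N \<in> measurable ?R (count_space UNIV)" "0 \<in> L" by fact+
    show "X j \<in> borel_measurable M" if "1 \<le> j" for j by (rule X[OF that])
    show "?V j \<in> borel_measurable ?R" for j by (rule V)
    show "emeasure M {\<omega> \<in> space M. N \<omega> = n} = 0" if "n \<notin> L" for n by (rule L(2)[OF that])
    fix n assume n: "n \<in> L"
    let ?I = "{..<Suc n}"
    let ?G = "PiM ?I (\<lambda>_. borel :: real measure)"
    let ?f = "\<lambda>(i, w). \<lambda>j\<in>?I. minmax (crm_generic N X j) (i j) (w j)"
    have "distr M ?G (\<lambda>\<omega>. \<lambda>j\<in>?I. if j = 0 then real (N \<omega>) else X j \<omega>) =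
        distr (measure_pmf (fgm_pmf \<theta> (Suc n)) \<Otimes>\<^sub>M PiM ?I (\<lambda>_. M \<Otimes>\<^sub>M M)) ?G ?f"
      using crm_stochastic_representation[OF crm joint[OF n]] by (simp only: crm_coord_def)
    \<comment> \<open>\<open>marg\<close> equates only restricted bit vectors, hence the passage
      through the marginals on \<open>?I\<close>.\<close>
    also have "\<dots> = distr (distr (measure_pmf (fgm_pmf \<theta> (Suc n))) (PiM ?I (\<lambda>_. count_space UNIV)) (\<lambda>i. restrict i ?I) \<Otimes>\<^sub>M PiM ?I (\<lambda>_. M \<Otimes>\<^sub>M M)) ?G ?f"
      by (rule minmax_family_distr_restrict[OF M measure_pmf.prob_space_axioms crm_generic_measurable[OF crm]]) auto
    also have "\<dots> = distr ?R ?G ?f"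
      unfolding marg[symmetric]
      by (rule minmax_family_distr_restrict[OF M Q crm_generic_measurable[OF crm], symmetric]) (auto intro: comp)
    also have "?f = (\<lambda>x. \<lambda>j\<in>?I. if j = 0 then real (?N x) else ?V j x)"
      unfolding case_prod_beta by (intro ext restrict_ext) (auto simp only: minmax_crm_generic_0 split: if_splits)
    finally show "distr M ?G (\<lambda>\<omega>. \<lambda>j\<in>?I. if j = 0 then real (N \<omega>) else X j \<omega>) =
      distr ?R ?G (\<lambda>x. \<lambda>j\<in>?I. if j = 0 then real (?N x) else ?V j x)" .
  qed
  moreover have "(\<lambda>x. \<Sum>j\<in>{1..?N x}. ?V j x) =
      (\<lambda>(i, w). \<Sum>j\<in>{1..if i 0 then max (N (fst (w 0))) (N (snd (w 0))) else min (N (fst (w 0))) (N (snd (w 0)))}.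
         minmax (crm_generic N X j) (i j) (w j))"
    by (rule ext) (simp only: case_prod_beta)
  moreover have "aggregate N X = (\<lambda>\<omega>. \<Sum>j\<in>{1..N \<omega>}. X j \<omega>)"
    by (rule ext) (rule aggregate_def)
  ultimately show ?thesis by (simp only:)
qed

theorem mainTheorem1:
  fixes M :: "'a measure" and N :: "'a \<Rightarrow> nat" and X :: "nat \<Rightarrow> 'a \<Rightarrow> real"
  assumes "aleph_FGM M N X"
  shows
    "(\<forall>k\<ge>1. enat k \<le> sup_support_N M N \<longrightarrow> (\<forall>\<theta>. fgm_rep M N X k \<theta> \<longrightarrow>
        distr M (PiM {0..k} (\<lambda>_. borel))
          (\<lambda>\<omega>. \<lambda>j\<in>{0..k}. if j = 0 then real (N \<omega>) else X j \<omega>)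
      = distr (measure_pmf (fgm_pmf \<theta> (Suc k)) \<Otimes>\<^sub>M PiM {0..k} (\<lambda>_. M \<Otimes>\<^sub>M M))
          (PiM {0..k} (\<lambda>_. borel))
          (\<lambda>(i, w). \<lambda>j\<in>{0..k}.
             if j = 0 then
               (1 - of_bool (i 0)) * real (min (N (fst (w 0))) (N (snd (w 0))))
               + of_bool (i 0) * real (max (N (fst (w 0))) (N (snd (w 0))))
             else
               (1 - of_bool (i j)) * min (X 1 (fst (w j))) (X 1 (snd (w j)))
               + of_bool (i j) * max (X 1 (fst (w j))) (X 1 (snd (w j))))))
   \<and>
    (\<exists>Q :: (nat \<Rightarrow> bool) measure.
       prob_space Q \<and>
       sets Q = sets (PiM UNIV (\<lambda>_::nat. count_space (UNIV :: bool set))) \<and>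
       (\<forall>j. measure Q {i \<in> space Q. i j} = 1 / 2) \<and>
       (\<forall>k\<ge>1. enat k \<le> sup_support_N M N \<longrightarrow> (\<exists>\<theta>. fgm_rep M N X k \<theta> \<and>
          distr Q (PiM {0..k} (\<lambda>_. count_space UNIV)) (\<lambda>i. restrict i {0..k})
          = distr (measure_pmf (fgm_pmf \<theta> (Suc k))) (PiM {0..k} (\<lambda>_. count_space UNIV))
              (\<lambda>i. restrict i {0..k}))) \<and>
       distr M borel (aggregate N X)
       = distr (Q \<Otimes>\<^sub>M PiM UNIV (\<lambda>_::nat. M \<Otimes>\<^sub>M M)) borel
           (\<lambda>(i, w).
              let Mc = (if i 0 then max (N (fst (w 0))) (N (snd (w 0)))
                        else min (N (fst (w 0))) (N (snd (w 0))))
              in (\<Sum>j\<in>{1..Mc}.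
                    (1 - of_bool (i j)) * min (X 1 (fst (w j))) (X 1 (snd (w j)))
                    + of_bool (i j) * max (X 1 (fst (w j))) (X 1 (snd (w j))))))"
    (is "?part1 \<and> (\<exists>Q. prob_space Q \<and> _ \<and> _ \<and> ?marg Q \<and> _ = distr (?R Q) borel ?S)")
proof
  have crm: "crm M N X" using assms by (simp add: aleph_FGM_def)
  interpret prob_space M by (rule crmD[OF crm])
  have I: "{0..k} = {..<Suc k}" for k :: nat by auto
  show ?part1
  proof (intro allI impI)
    fix k \<theta> assume "fgm_rep M N X k \<theta>"
    then have joint: "fgm_joint M (crm_coord N X) (Suc k) \<theta>"
      by (simp only: fgm_rep_iff_fgm_joint[OF crm])
    have "(\<lambda>(i, w). \<lambda>j\<in>{0..k}. minmax (crm_generic N X j) (i j) (w j)) =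
        (\<lambda>(i, w). \<lambda>j\<in>{0..k}.
             if j = 0 then
               (1 - of_bool (i 0)) * real (min (N (fst (w 0))) (N (snd (w 0))))
               + of_bool (i 0) * real (max (N (fst (w 0))) (N (snd (w 0))))
             else
               (1 - of_bool (i j)) * min (X 1 (fst (w j))) (X 1 (snd (w j)))
               + of_bool (i j) * max (X 1 (fst (w j))) (X 1 (snd (w j))))"
    proof (rule ext, unfold case_prod_beta, rule restrict_ext)
      fix x :: "(nat \<Rightarrow> bool) \<times> (nat \<Rightarrow> 'a \<times> 'a)" and j
      show "minmax (crm_generic N X j) (fst x j) (snd x j) =
         (if j = 0 then
               (1 - of_bool (fst x 0)) * real (min (N (fst (snd x 0))) (N (snd (snd x 0))))
               + of_bool (fst x 0) * real (max (N (fst (snd x 0))) (N (snd (snd x 0))))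
             else
               (1 - of_bool (fst x j)) * min (X 1 (fst (snd x j))) (X 1 (snd (snd x j)))
               + of_bool (fst x j) * max (X 1 (fst (snd x j))) (X 1 (snd (snd x j))))"
        by (cases "j = 0") (simp_all add: minmax_crm_generic_0 minmax_crm_generic_pos)
    qed
    with crm_stochastic_representation[OF crm joint]
    show "distr M (PiM {0..k} (\<lambda>_. borel))
          (\<lambda>\<omega>. \<lambda>j\<in>{0..k}. if j = 0 then real (N \<omega>) else X j \<omega>)
      = distr (measure_pmf (fgm_pmf \<theta> (Suc k)) \<Otimes>\<^sub>M PiM {0..k} (\<lambda>_. M \<Otimes>\<^sub>M M))
          (PiM {0..k} (\<lambda>_. borel))
          (\<lambda>(i, w). \<lambda>j\<in>{0..k}.
             if j = 0 then
               (1 - of_bool (i 0)) * real (min (N (fst (w 0))) (N (snd (w 0))))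
               + of_bool (i 0) * real (max (N (fst (w 0))) (N (snd (w 0))))
             else
               (1 - of_bool (i j)) * min (X 1 (fst (w j))) (X 1 (snd (w j)))
               + of_bool (i j) * max (X 1 (fst (w j))) (X 1 (snd (w j))))"
      by (simp only: crm_coord_def I)
  qed
  \<comment> \<open>An initial segment of the naturals containing 0, finite exactly when the support
    of the count is bounded.\<close>
  define L where "L = {k. enat k \<le> sup_support_N M N}"
  have ex: "\<exists>\<theta>. fgm_joint M (crm_coord N X) (Suc k) \<theta>" if "k \<in> L" for k
  proof (cases "k = 0")
    case False
    then have "\<exists>\<theta>. fgm_rep M N X k \<theta>"
      using assms that unfolding aleph_FGM_def L_def by auto
    then show ?thesis by (simp only: fgm_rep_iff_fgm_joint[OF crm])
  qed (use fgm_joint_1 in auto)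
  have down: "l \<in> L" if "k \<in> L" "l \<le> k" for k l
    using that order_trans[of "enat l" "enat k"] by (simp add: L_def)
  obtain \<Theta> where valid: "\<And>d. fgm_valid \<Theta> d" and joint: "\<And>k. k \<in> L \<Longrightarrow> fgm_joint M (crm_coord N X) (Suc k) \<Theta>"
    by (rule fgm_joint_compatible[OF crm_coord_measurable[OF crm] ex down]) blast+
  obtain Q :: "(nat \<Rightarrow> bool) measure" where Q: "prob_space Q" and sQ: "sets Q = sets (PiM UNIV (\<lambda>_. count_space UNIV))"
    and marg: "\<And>d. distr Q (PiM {..<d} (\<lambda>_. count_space UNIV)) (\<lambda>i. restrict i {..<d}) =
      distr (measure_pmf (fgm_pmf \<Theta> d)) (PiM {..<d} (\<lambda>_. count_space UNIV)) (\<lambda>i. restrict i {..<d})"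
    by (rule ex_fgm_sequence[OF valid]) blast
  \<comment> \<open>Bit \<open>j\<close> is visible in the marginal on the first
    \<open>Suc j\<close> bits, which is known in every dimension, including those above the supremum
    of the support.\<close>
  have half: "measure Q {i \<in> space Q. i j} = 1 / 2" for j
  proof -
    let ?I = "{..<Suc j}"
    let ?B = "PiM ?I (\<lambda>_. count_space (UNIV :: bool set))"
    let ?E = "(\<lambda>i. i j) -` {True} \<inter> space ?B"
    have E: "?E \<in> sets ?B"
      by (rule measurable_sets[OF measurable_component_singleton]) auto
    have r: "(\<lambda>i. restrict i ?I) \<in> measurable Q ?B"
      unfolding measurable_cong_sets[OF sQ refl] by (rule measurable_restrict_subset) simp
    have r': "(\<lambda>i. restrict i ?I) \<in> measurable (measure_pmf (fgm_pmf \<Theta> (Suc j))) ?B"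
      by (simp add: space_PiM)
    have "{i \<in> space Q. i j} = (\<lambda>i. restrict i ?I) -` ?E \<inter> space Q"
      by (rule set_eqI) (simp add: space_PiM conj_commute)
    then have "measure Q {i \<in> space Q. i j} = measure (distr Q ?B (\<lambda>i. restrict i ?I)) ?E"
      by (simp only: measure_distr[OF r E])
    also have "\<dots> = measure (measure_pmf (fgm_pmf \<Theta> (Suc j))) ((\<lambda>i. restrict i ?I) -` ?E)"
      unfolding marg measure_distr[OF r' E] by simp
    also have "(\<lambda>i. restrict i ?I) -` ?E = {i. i j}"
      by (rule set_eqI) (simp add: space_PiM)
    finally show ?thesis by (simp add: measure_fgm_pmf_component[OF valid])
  qed
  have rep: "?marg Q"
  proof (intro allI impI)
    \<comment> \<open>One and the same \<open>\<Theta>\<close> is the witness for every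
      \<open>k\<close>.\<close>
    fix k assume "enat k \<le> sup_support_N M N"
    then have "fgm_rep M N X k \<Theta>"
      using joint by (simp add: L_def fgm_rep_iff_fgm_joint[OF crm])
    then show "\<exists>\<theta>. fgm_rep M N X k \<theta> \<and>
          distr Q (PiM {0..k} (\<lambda>_. count_space UNIV)) (\<lambda>i. restrict i {0..k})
          = distr (measure_pmf (fgm_pmf \<theta> (Suc k))) (PiM {0..k} (\<lambda>_. count_space UNIV))
              (\<lambda>i. restrict i {0..k})"
      using marg[of "Suc k"] unfolding I by blast
  qed
  have null: "emeasure M {\<omega> \<in> space M. N \<omega> = n} = 0" if "n \<notin> L" for n
  proof -
    have "n \<notin> support_N M N"
    proof
      assume "n \<in> support_N M N"
      then have "enat n \<le> sup_support_N M N" unfolding sup_support_N_def by (intro Sup_upper imageI)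
      then show False using that by (simp add: L_def)
    qed
    then have "measure M {\<omega> \<in> space M. N \<omega> = n} = 0"
      using measure_nonneg[of M "{\<omega> \<in> space M. N \<omega> = n}"] by (simp add: support_N_def)
    then show ?thesis by (simp add: emeasure_eq_measure)
  qed
  have "0 \<in> L" by (simp add: L_def zero_enat_def[symmetric])
  have S: "?S = (\<lambda>(i, w). \<Sum>j\<in>{1..if i 0 then max (N (fst (w 0))) (N (snd (w 0))) else min (N (fst (w 0))) (N (snd (w 0)))}.
         minmax (crm_generic N X j) (i j) (w j))"
    by (rule ext, unfold case_prod_beta Let_def, rule sum.cong[OF refl], rule minmax_crm_generic_pos[symmetric]) simp
  have agg: "distr M borel (aggregate N X) = distr (?R Q) borel ?S"
    unfolding S by (rule aggregate_representation[OF crm Q sQ marg joint \<open>0 \<in> L\<close> null])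
  show "\<exists>Q. prob_space Q \<and> sets Q = sets (PiM UNIV (\<lambda>_::nat. count_space (UNIV :: bool set))) \<and>
      (\<forall>j. measure Q {i \<in> space Q. i j} = 1 / 2) \<and> ?marg Q \<and> distr M borel (aggregate N X) = distr (?R Q) borel ?S"
    by (intro exI[of _ Q] conjI allI Q sQ half rep agg)
qed

end
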